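(* Let $G$ be a small finite subgroup of $\mathrm{GL}_2(\mathbb{C})$ which is not contained in $\mathrm{SL}_2(\mathbb{C})$. Then $\mathbb{C}[\mathbb{C}^2]\rtimes G$ has no nontrivial (relative to $\mathbb{C}G$) PBW deformations.
   Context: A finite subgroup $G<\mathrm{GL}_2(\mathbb{C})$ is small if it contains no pseudo-reflections (non-identity elements fixing a hyperplane pointwise). $\mathbb{C}[\mathbb{C}^2]\rtimes G$ is the skew group algebra with multiplication $(f_1,g_1)(f_2,g_2)=(f_1 f_2^{g_1},g_1g_2)$, where $\mathbb{C}[\mathbb{C}^2]=\mathrm{Sym}((\mathbb{C}^2)^* )$, graded with $G$ in degree $0$ and $(\mathbb{C}^2)^*$ in degree $1$. Let $S=\mathbb{C}G$, $S^e=S\otimes_{\mathbb{C}}S^{op}$, and let $V=(\mathbb{C}^2)^*\otimes_{\mathbb{C}}\mathbb{C}G$ be the $S$-bimodule with $g(x\otimes h)k=gx\otimes ghk$ for $g,h,k\in G$. Then $T_S(V)=T_{\mathbb{C}}((\mathbb{C}^2)^* )\rtimes G$ and $\mathbb{C}[\mathbb{C}^2]\rtimes G=T_S(V)/I(R)$, where $R\subset V\otimes_S V$ is the $S^e$-submodule generated by the commutators $xy-yx$, $x,y\in(\mathbb{C}^2)^*$, and $I(X)$ denotes the two-sided ideal generated by $X$. PBW deformations relative to $S$. Let $F^m=V^{\otimes_S m}\oplus\dots\oplus V\oplus S$ and let $P\subset F^2$ be an $S^e$-submodule whose image under the projection $F^2\to V\otimes_S V$ equals $R$. The algebra $\mathcal{A}=T_S(V)/I(P)$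 is filtered by the images of the $F^m$, and there is a natural surjective graded map $T_S(V)/I(R)\to\mathrm{gr}(\mathcal{A})$; $\mathcal{A}$ is a PBW deformation if this map is an isomorphism. In that case $P=\{r-\theta_1(r)-\theta_0(r):r\in R\}$ for unique $S^e$-module maps $\theta_1:R\to V$ and $\theta_0:R\to S$. The deformation is trivial if $\theta_1=0$ and $\theta_0=0$ (i.e. $P=R$), and nontrivial otherwise. *)

theory Defs
  imports "HOL-Analysis.Analysis" "HOL-Algebra.QuotRing" "HOL-Library.Poly_Mapping"
begin

type_synonym mat2 = "complex^2^2"

definition GL2 :: "mat2 monoid" where
  "GL2 = \<lparr>carrier = {g. invertible g}, mult = (**), one = mat 1\<rparr>"

definition SL2 :: "mat2 set" where
  "SL2 = {g. det g = 1}"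

definition pseudo_reflection :: "mat2 \<Rightarrow> bool" where
  "pseudo_reflection g \<longleftrightarrow> g \<noteq> mat 1 \<and>
     (\<exists>H. vec.subspace H \<and> vec.dim H = CARD(2) - 1 \<and> (\<forall>v\<in>H. g *v v = v))"

definition small :: "mat2 set \<Rightarrow> bool" where
  "small G \<longleftrightarrow> (\<forall>g\<in>G. \<not> pseudo_reflection g)"

text \<open>Lists form the free monoid, so that \<open>2 list \<Rightarrow>\<^sub>0 complex\<close>, with the convolution product of
  \<^theory>\<open>HOL-Library.Poly_Mapping\<close>, is the free algebra on two letters.\<close>

instantiation list :: (type) monoid_add
begin

definition zero_list :: "'a list" where
  "zero_list = []"

definition plus_list :: "'a list \<Rightarrow> 'a list \<Rightarrow> 'a list" where
  "plus_list = (@)"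

instance
  by standard (simp_all add: zero_list_def plus_list_def)

end

text \<open>The letter \<open>i :: 2\<close> stands for the \<open>i\<close>-th coordinate functional, and a word
  \<open>[i\<^sub>1, \<dots>, i\<^sub>m]\<close> for the tensor product of the corresponding functionals.\<close>

type_synonym tensor = "2 list \<Rightarrow>\<^sub>0 complex"

definition dual_space :: "(complex^2 \<Rightarrow> complex) set" where
  "dual_space = {x. Vector_Spaces.linear (*s) (*) x}"

definition tensor_of_dual :: "(complex^2 \<Rightarrow> complex) \<Rightarrow> tensor" where
  "tensor_of_dual x = (\<Sum>i\<in>UNIV. Poly_Mapping.single [i] (x (axis i 1)))"

definition dual_act :: "mat2 \<Rightarrow> (complex^2 \<Rightarrow> complex) \<Rightarrow> (complex^2 \<Rightarrow> complex)" where
  "dual_act g x = (\<lambda>v. x (matrix_inv g *v v))"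

text \<open>The action of \<open>g\<close> by the algebra automorphism that extends \<^const>\<open>dual_act\<close>.\<close>

definition tensor_act :: "mat2 \<Rightarrow> tensor \<Rightarrow> tensor" where
  "tensor_act g p = (\<Sum>w\<in>Poly_Mapping.keys p. Poly_Mapping.single [] (Poly_Mapping.lookup p w) *
     prod_list (map (\<lambda>i. tensor_of_dual (dual_act g (\<lambda>v. v $ i))) w))"

definition tensor_component :: "nat \<Rightarrow> tensor \<Rightarrow> tensor" where
  "tensor_component m p = (\<Sum>w | w \<in> Poly_Mapping.keys p \<and> length w = m.
     Poly_Mapping.single w (Poly_Mapping.lookup p w))"

text \<open>A function \<open>f\<close> supported on the finite group \<open>G\<close> stands for \<open>\<Sum>g\<in>G. (f g, g)\<close>; the product
  below is the bilinear extension of \<open>(f\<^sub>1, g\<^sub>1) (f\<^sub>2, g\<^sub>2) = (f\<^sub>1 f\<^sub>2\<^bsup>g\<^sub>1\<^esup>, g\<^sub>1 g\<^sub>2)\<close>.\<close>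

definition skew_group_algebra ::
    "mat2 set \<Rightarrow> (mat2 \<Rightarrow> 'a \<Rightarrow> 'a) \<Rightarrow> (mat2 \<Rightarrow> 'a::ring_1) ring" where
  "skew_group_algebra G act =
    \<lparr>carrier = {f. \<forall>g. g \<notin> G \<longrightarrow> f g = 0},
     mult = (\<lambda>f f' k. \<Sum>(g, h) | g \<in> G \<and> h \<in> G \<and> g ** h = k. f g * act g (f' h)),
     one = (\<lambda>g. if g = mat 1 then 1 else 0),
     zero = (\<lambda>g. 0),
     add = (\<lambda>f f' g. f g + f' g)\<rparr>"

text \<open>\<open>T\<^sub>S(V)\<close> in the form \<open>T\<^sub>\<complex>((\<complex>\<^sup>2)\<^sup>*) \<rtimes> G\<close>. Here \<open>V = (\<complex>\<^sup>2)\<^sup>* \<otimes> \<complex>G\<close> is the part of degree 1, with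
  \<open>x \<otimes> g\<close> being \<open>(x, g)\<close>; its bimodule structure \<open>g(x \<otimes> h)k = gx \<otimes> ghk\<close> is given by the product
  with elements of degree 0, and \<open>V \<otimes>\<^sub>S \<dots> \<otimes>\<^sub>S V\<close> (\<open>m\<close> factors) is the part of degree \<open>m\<close>.\<close>

definition TSV :: "mat2 set \<Rightarrow> (mat2 \<Rightarrow> tensor) ring" where
  "TSV G = skew_group_algebra G tensor_act"

definition TSV_degree :: "mat2 set \<Rightarrow> nat \<Rightarrow> (mat2 \<Rightarrow> tensor) set" where
  "TSV_degree G m =
     {t \<in> carrier (TSV G). \<forall>g. \<forall>w\<in>Poly_Mapping.keys (t g). length w = m}"

definition TSV_filt :: "mat2 set \<Rightarrow> nat \<Rightarrow> (mat2 \<Rightarrow> tensor) set" where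
  "TSV_filt G m =
     {t \<in> carrier (TSV G). \<forall>g. \<forall>w\<in>Poly_Mapping.keys (t g). length w \<le> m}"

definition component :: "nat \<Rightarrow> (mat2 \<Rightarrow> tensor) \<Rightarrow> (mat2 \<Rightarrow> tensor)" where
  "component m t = (\<lambda>g. tensor_component m (t g))"

abbreviation group_alg :: "mat2 set \<Rightarrow> (mat2 \<Rightarrow> tensor) set" where
  "group_alg G \<equiv> TSV_degree G 0"

abbreviation V_bimod :: "mat2 set \<Rightarrow> (mat2 \<Rightarrow> tensor) set" where
  "V_bimod G \<equiv> TSV_degree G 1"

text \<open>\<open>S\<^sup>e\<close>-submodules of \<open>T\<^sub>S(V)\<close> and \<open>S\<^sup>e\<close>-module maps between them. Since \<open>\<complex> \<subseteq> S\<close> is central in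
  \<open>T\<^sub>S(V)\<close>, these are automatically complex subspaces and complex linear.\<close>

definition Se_submodule :: "mat2 set \<Rightarrow> (mat2 \<Rightarrow> tensor) set \<Rightarrow> bool" where
  "Se_submodule G M \<longleftrightarrow>
     M \<subseteq> carrier (TSV G) \<and> \<zero>\<^bsub>TSV G\<^esub> \<in> M \<and>
     (\<forall>a\<in>M. \<forall>b\<in>M. a \<oplus>\<^bsub>TSV G\<^esub> b \<in> M) \<and>
     (\<forall>s\<in>group_alg G. \<forall>a\<in>M. s \<otimes>\<^bsub>TSV G\<^esub> a \<in> M \<and> a \<otimes>\<^bsub>TSV G\<^esub> s \<in> M)"

definition Se_map ::
    "mat2 set \<Rightarrow> (mat2 \<Rightarrow> tensor) set \<Rightarrow> (mat2 \<Rightarrow> tensor) set \<Rightarrow>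
     ((mat2 \<Rightarrow> tensor) \<Rightarrow> (mat2 \<Rightarrow> tensor)) \<Rightarrow> bool" where
  "Se_map G M N \<theta> \<longleftrightarrow>
     \<theta> \<in> M \<rightarrow> N \<and>
     (\<forall>a\<in>M. \<forall>b\<in>M. \<theta> (a \<oplus>\<^bsub>TSV G\<^esub> b) = \<theta> a \<oplus>\<^bsub>TSV G\<^esub> \<theta> b) \<and>
     (\<forall>s\<in>group_alg G. \<forall>a\<in>M. \<theta> (s \<otimes>\<^bsub>TSV G\<^esub> a) = s \<otimes>\<^bsub>TSV G\<^esub> \<theta> a \<and>
                                \<theta> (a \<otimes>\<^bsub>TSV G\<^esub> s) = \<theta> a \<otimes>\<^bsub>TSV G\<^esub> s)"

text \<open>\<open>R \<subseteq> V \<otimes>\<^sub>S V\<close>, and the algebra \<open>T\<^sub>S(V)/I(R) = \<complex>[\<complex>\<^sup>2] \<rtimes> G\<close>.\<close>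

definition commutators :: "(mat2 \<Rightarrow> tensor) set" where
  "commutators =
     {(\<lambda>g. if g = mat 1 then tensor_of_dual x * tensor_of_dual y - tensor_of_dual y * tensor_of_dual x
           else 0) | x y. x \<in> dual_space \<and> y \<in> dual_space}"

definition relations :: "mat2 set \<Rightarrow> (mat2 \<Rightarrow> tensor) set" where
  "relations G = Se_submodule G hull commutators"

definition quot_alg :: "mat2 set \<Rightarrow> (mat2 \<Rightarrow> tensor) set \<Rightarrow> (mat2 \<Rightarrow> tensor) set ring" where
  "quot_alg G P = TSV G Quot (Idl\<^bsub>TSV G\<^esub> P)"

abbreviation polynomial_skew_algebra :: "mat2 set \<Rightarrow> (mat2 \<Rightarrow> tensor) set ring" where
  "polynomial_skew_algebra G \<equiv> quot_alg G (relations G)"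

definition filt_pred :: "('a, 'b) ring_scheme \<Rightarrow> (nat \<Rightarrow> 'a set) \<Rightarrow> nat \<Rightarrow> 'a set" where
  "filt_pred A F m = (case m of 0 \<Rightarrow> {\<zero>\<^bsub>A\<^esub>} | Suc k \<Rightarrow> F k)"

text \<open>An element of \<open>gr(A) = \<Oplus>\<^sub>m F\<^sup>m/F\<^bsup>m-1\<^esup>\<close> is a sequence of cosets, almost all of them zero. As in
  \<^const>\<open>rcoset_mult\<close>, the product is the union over all choices of representatives
  (all choices give the same coset when \<open>F\<close> is a ring filtration).\<close>

definition assoc_graded :: "('a, 'b) ring_scheme \<Rightarrow> (nat \<Rightarrow> 'a set) \<Rightarrow> (nat \<Rightarrow> 'a set) ring" where
  "assoc_graded A F =
    \<lparr>carrier = {a. (\<forall>m. \<exists>x\<in>F m. a m = filt_pred A F m +>\<^bsub>A\<^esub> x) \<and>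
                   finite {m. a m \<noteq> filt_pred A F m}},
     mult = (\<lambda>a b m. \<Union>{filt_pred A F m +>\<^bsub>A\<^esub> (\<Oplus>\<^bsub>A\<^esub> i\<in>{..m}. x i \<otimes>\<^bsub>A\<^esub> y (m - i)) | x y.
                          (\<forall>i. x i \<in> a i) \<and> (\<forall>i. y i \<in> b i)}),
     one = (\<lambda>m. if m = 0 then filt_pred A F 0 +>\<^bsub>A\<^esub> \<one>\<^bsub>A\<^esub> else filt_pred A F m),
     zero = filt_pred A F,
     add = (\<lambda>a b m. a m <+>\<^bsub>A\<^esub> b m)\<rparr>"

definition quot_filt ::
    "mat2 set \<Rightarrow> (mat2 \<Rightarrow> tensor) set \<Rightarrow> nat \<Rightarrow> (mat2 \<Rightarrow> tensor) set set" where
  "quot_filt G P m = (\<lambda>t. (Idl\<^bsub>TSV G\<^esub> P) +>\<^bsub>TSV G\<^esub> t) ` TSV_filt G m"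

definition gr_quot ::
    "mat2 set \<Rightarrow> (mat2 \<Rightarrow> tensor) set \<Rightarrow> (nat \<Rightarrow> (mat2 \<Rightarrow> tensor) set set) ring" where
  "gr_quot G P = assoc_graded (quot_alg G P) (quot_filt G P)"

text \<open>\<open>graded_map\<close> sends \<open>t \<in> T\<^sub>S(V)\<close> to the sequence of classes of its homogeneous components; for a
  deformation \<open>P\<close> it is constant on the cosets of \<open>I(R)\<close>, and \<open>natural_map\<close> is the induced map
  \<open>T\<^sub>S(V)/I(R) \<rightarrow> gr(T\<^sub>S(V)/I(P))\<close>.\<close>

definition graded_map ::
    "mat2 set \<Rightarrow> (mat2 \<Rightarrow> tensor) set \<Rightarrow> (mat2 \<Rightarrow> tensor) \<Rightarrow> nat \<Rightarrow> (mat2 \<Rightarrow> tensor) set set" where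
  "graded_map G P t = (\<lambda>m. filt_pred (quot_alg G P) (quot_filt G P) m
     +>\<^bsub>quot_alg G P\<^esub> ((Idl\<^bsub>TSV G\<^esub> P) +>\<^bsub>TSV G\<^esub> component m t))"

definition natural_map ::
    "mat2 set \<Rightarrow> (mat2 \<Rightarrow> tensor) set \<Rightarrow> (mat2 \<Rightarrow> tensor) set \<Rightarrow> nat \<Rightarrow> (mat2 \<Rightarrow> tensor) set set" where
  "natural_map G P X = the_elem (graded_map G P ` X)"

definition deformation :: "mat2 set \<Rightarrow> (mat2 \<Rightarrow> tensor) set \<Rightarrow> bool" where
  "deformation G P \<longleftrightarrow>
     Se_submodule G P \<and> P \<subseteq> TSV_filt G 2 \<and> component 2 ` P = relations G"

definition PBW_deformation :: "mat2 set \<Rightarrow> (mat2 \<Rightarrow> tensor) set \<Rightarrow> bool" where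
  "PBW_deformation G P \<longleftrightarrow>
     deformation G P \<and>
     natural_map G P \<in> ring_iso (polynomial_skew_algebra G) (gr_quot G P)"

definition deformation_maps ::
    "mat2 set \<Rightarrow> (mat2 \<Rightarrow> tensor) set \<Rightarrow> ((mat2 \<Rightarrow> tensor) \<Rightarrow> (mat2 \<Rightarrow> tensor)) \<Rightarrow>
     ((mat2 \<Rightarrow> tensor) \<Rightarrow> (mat2 \<Rightarrow> tensor)) \<Rightarrow> bool" where
  "deformation_maps G P \<theta>\<^sub>1 \<theta>\<^sub>0 \<longleftrightarrow>
     Se_map G (relations G) (V_bimod G) \<theta>\<^sub>1 \<and>
     Se_map G (relations G) (group_alg G) \<theta>\<^sub>0 \<and>
     P = {r \<ominus>\<^bsub>TSV G\<^esub> \<theta>\<^sub>1 r \<ominus>\<^bsub>TSV G\<^esub> \<theta>\<^sub>0 r | r. r \<in> relations G}"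

text \<open>The maps are unique as functions on \<open>R\<close>, so it does not matter that they are bound
  existentially here; the condition amounts to \<open>P = R\<close>.\<close>

definition trivial_deformation :: "mat2 set \<Rightarrow> (mat2 \<Rightarrow> tensor) set \<Rightarrow> bool" where
  "trivial_deformation G P \<longleftrightarrow>
     (\<exists>\<theta>\<^sub>1 \<theta>\<^sub>0. deformation_maps G P \<theta>\<^sub>1 \<theta>\<^sub>0 \<and>
        (\<forall>r\<in>relations G. \<theta>\<^sub>1 r = \<zero>\<^bsub>TSV G\<^esub> \<and> \<theta>\<^sub>0 r = \<zero>\<^bsub>TSV G\<^esub>))"

end

theory Submission
  imports Defs
begin

text \<open>
  Let \<open>c = xy - yx\<close> be the commutator that spans the relations over \<open>\<complex>G\<close>, and let \<open>p \<in> P\<close> have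
  \<open>c\<close> as its quadratic part. The PBW property implies that \<open>P\<close> contains no nonzero element of degree
  at most 1. Conjugation by \<open>g \<in> G\<close> multiplies \<open>c\<close> by \<open>1 / det g\<close>, hence it multiplies \<open>p\<close> by the same
  factor. Compare the coefficients of \<open>p - c\<close> at \<open>h \<in> G\<close> for an element \<open>x\<close> that commutes with \<open>h\<close> and
  has \<open>det x \<noteq> 1\<close>: the constant coefficient vanishes because \<open>det x \<noteq> 1\<close>, and the linear one because
  otherwise \<open>x\<close> would have the eigenvalue 1 and be a pseudo-reflection. So \<open>p = c\<close>, and \<open>P = R\<close>.

  It remains to find \<open>x\<close> for every \<open>h\<close>. If all elements that commute with \<open>h\<close> have determinant 1, then
  \<open>h\<close> is not scalar and all scalars in \<open>G\<close> have determinant 1. Let \<open>g \<in> G\<close> have determinant different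
  from 1. The centralizer of \<open>g\<close> is its own normalizer, because an
  element that exchanges the two eigenlines of \<open>g\<close> is traceless, and traceless elements of \<open>G\<close> have
  determinant 1. Modulo scalars \<open>g\<close> has order at least 4. Counting the conjugates of the two
  centralizers as in the class equation of a polyhedral group gives more than \<open>|G|\<close> elements.
\<close>

section \<open>Centralizers in small groups\<close>

lemma mat2_mult_nth:
  fixes A B :: mat2
  shows "(A ** B) $ i $ j = A $ i $ 1 * B $ 1 $ j + A $ i $ 2 * B $ 2 $ j"
  by (simp add: matrix_matrix_mult_def sum_2)

lemma mat2_eq_iff:
  fixes A B :: mat2
  shows "A = B \<longleftrightarrow> A $ 1 $ 1 = B $ 1 $ 1 \<and> A $ 1 $ 2 = B $ 1 $ 2 \<and>
    A $ 2 $ 1 = B $ 2 $ 1 \<and> A $ 2 $ 2 = B $ 2 $ 2"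
  by (auto simp: vec_eq_iff forall_2)

lemma mat_nth2:
  "(mat c :: mat2) $ 1 $ 1 = c" "(mat c :: mat2) $ 1 $ 2 = 0"
  "(mat c :: mat2) $ 2 $ 1 = 0" "(mat c :: mat2) $ 2 $ 2 = c"
  by (simp_all add: mat_def)

lemma trace_2: "trace (A :: mat2) = A $ 1 $ 1 + A $ 2 $ 2"
  by (simp add: trace_def sum_2)

lemmas mat2_simps = mat2_eq_iff mat2_mult_nth mat_nth2 trace_2 det_2

definition scalar_mat :: "mat2 \<Rightarrow> bool" where
  "scalar_mat A \<longleftrightarrow> (\<exists>c. A = mat c)"

lemma scalar_mat_commutes:
  assumes "scalar_mat A"
  shows "A ** B = B ** A"
  using assms by (auto simp: scalar_mat_def mat2_simps)

lemma mat2_minus_mult: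
  fixes A B :: mat2
  shows "(- A) ** B = - (A ** B)" and "A ** (- B) = - (A ** B)"
  by (simp_all add: mat2_simps)

lemma mat2_add_mult:
  fixes A B C :: mat2
  shows "(A + B) ** C = A ** C + B ** C"
  by (simp add: mat2_simps algebra_simps)

lemma trace_minus: "trace (- A) = - trace (A :: mat2)"
  by (simp add: trace_2)

lemma mat_0: "mat 0 = (0 :: mat2)"
  by (simp add: mat2_simps)

text \<open>Comparing entries of the two products shows that the triple of off-diagonal entries and
  diagonal difference of \<open>A\<close> is proportional to that of \<open>B\<close>. The latter is
  nonzero because \<open>B\<close> is not scalar; \<open>a\<close> is the ratio, read off at a
  nonzero entry of the triple, and \<open>b\<close> corrects the diagonal.\<close>

lemma commuting_nonscalar:
  fixes A B :: mat2
  assumes AB: "A ** B = B ** A" and B: "\<not> scalar_mat B"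
  obtains a b where "A = mat a ** B + mat b"
proof -
  have "A$1$2 * B$2$1 - B$1$2 * A$2$1 = (A ** B)$1$1 - (B ** A)$1$1"
    by (simp add: mat2_mult_nth)
  then have 1: "A$1$2 * B$2$1 = B$1$2 * A$2$1"
    by (simp add: AB)
  have "A$1$2 * (B$2$2 - B$1$1) - B$1$2 * (A$2$2 - A$1$1) = (A ** B)$1$2 - (B ** A)$1$2"
    by (simp add: mat2_mult_nth algebra_simps)
  then have 2: "A$1$2 * (B$2$2 - B$1$1) = B$1$2 * (A$2$2 - A$1$1)"
    by (simp add: AB)
  have "A$2$1 * (B$2$2 - B$1$1) - B$2$1 * (A$2$2 - A$1$1) = (B ** A)$2$1 - (A ** B)$2$1"
    by (simp add: mat2_mult_nth algebra_simps)
  then have 3: "A$2$1 * (B$2$2 - B$1$1) = B$2$1 * (A$2$2 - A$1$1)"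
    by (simp add: AB)
  have "\<exists>a b. A = mat a ** B + mat b"
  proof (cases "B$1$2 = 0")
    case False
    show ?thesis
      by (rule exI[of _ "A$1$2 / B$1$2"], rule exI[of _ "A$1$1 - A$1$2 / B$1$2 * B$1$1"])
        (use False 1 2 3 in \<open>simp add: mat2_simps field_simps\<close>)
  next
    case B12: True
    show ?thesis
    proof (cases "B$2$1 = 0")
      case False
      show ?thesis
        by (rule exI[of _ "A$2$1 / B$2$1"], rule exI[of _ "A$1$1 - A$2$1 / B$2$1 * B$1$1"])
          (use False 1 2 3 B12 in \<open>simp add: mat2_simps field_simps\<close>)
    next
      case True
      with B12 B have ne: "B$2$2 - B$1$1 \<noteq> 0"
        by (auto simp: scalar_mat_def mat2_simps)
      define q where "q = (A$2$2 - A$1$1) / (B$2$2 - B$1$1)"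
      have "q * (B$2$2 - B$1$1) = A$2$2 - A$1$1"
        using ne by (simp add: q_def)
      then show ?thesis
        by (intro exI[of _ q] exI[of _ "A$1$1 - q * B$1$1"])
          (use True B12 ne 2 3 in \<open>auto simp: mat2_simps algebra_simps\<close>)
    qed
  qed
  then show thesis using that by blast
qed

lemma cayley_hamilton_2:
  fixes A :: mat2
  shows "A ** A = mat (trace A) ** A - mat (det A)"
  by (simp add: mat2_simps algebra_simps)

lemma group_GL2: "group GL2"
proof (rule groupI)
  fix x assume "x \<in> carrier GL2"
  then show "\<exists>y\<in>carrier GL2. y \<otimes>\<^bsub>GL2\<^esub> x = \<one>\<^bsub>GL2\<^esub>"
    by (auto simp: GL2_def invertible_def)
qed (auto simp: GL2_def invertible_mult matrix_mul_assoc invertible_det_nz det_mul)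

locale finite_mat_group =
  fixes G :: "mat2 set"
  assumes subgroup: "subgroup G GL2" and finite: "finite G"
begin

lemma one_closed: "mat 1 \<in> G"
  using subgroup.one_closed[OF subgroup] by (simp add: GL2_def)

lemma mult_closed: "a \<in> G \<Longrightarrow> b \<in> G \<Longrightarrow> a ** b \<in> G"
  using subgroup.m_closed[OF subgroup] by (simp add: GL2_def)

lemma invertible_mem: "a \<in> G \<Longrightarrow> invertible a"
  using subgroup.subset[OF subgroup] by (auto simp: GL2_def)

lemma
  assumes "a \<in> G"
  shows inv_right: "a ** matrix_inv a = mat 1" and inv_left: "matrix_inv a ** a = mat 1"
proof -
  have "\<exists>b. a ** b = mat 1 \<and> b ** a = mat 1"
    using invertible_mem[OF assms] by (simp add: invertible_def)
  from someI_ex[OF this] show "a ** matrix_inv a = mat 1" "matrix_inv a ** a = mat 1"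
    by (simp_all add: matrix_inv_def)
qed

lemma inv_closed:
  assumes "a \<in> G"
  shows "matrix_inv a \<in> G"
proof -
  have "invertible (matrix_inv a)"
    using inv_left inv_right assms by (auto simp: invertible_def)
  then have "inv\<^bsub>GL2\<^esub> a = matrix_inv a"
    using assms
    by (intro group.inv_equality[OF group_GL2]) (auto simp: GL2_def inv_left invertible_mem)
  then show ?thesis
    using subgroup.m_inv_closed[OF subgroup assms] by simp
qed

lemma det_nonzero: "a \<in> G \<Longrightarrow> det a \<noteq> 0"
  using invertible_mem invertible_det_nz by blast

lemma inv_left_cancel: "a \<in> G \<Longrightarrow> matrix_inv a ** (a ** b) = b"
  by (simp add: matrix_mul_assoc inv_left)

lemma inv_right_cancel: "a \<in> G \<Longrightarrow> a ** (matrix_inv a ** b) = b"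
  by (simp add: matrix_mul_assoc inv_right)

lemma mult_left_cancel: "a \<in> G \<Longrightarrow> a ** (b :: mat2) = a ** c \<longleftrightarrow> b = c"
  by (metis inv_left_cancel)

lemma mult_right_cancel: "a \<in> G \<Longrightarrow> (b :: mat2) ** a = c ** a \<longleftrightarrow> b = c"
  by (metis inv_right matrix_mul_assoc matrix_mul_rid)

text \<open>The powers of \<open>s + N\<close> with \<open>N\<^sup>2 = 0\<close> are \<open>s\<^sup>n + n s\<^bsup>n-1\<^esup> N\<close>, which are pairwise different
  unless \<open>N = 0\<close>.\<close>
lemma nilpotent_part_zero:
  assumes h: "mat s + N \<in> G" and N: "N ** N = 0"
  shows "N = 0"
proof (rule ccontr)
  assume "N \<noteq> 0"
  define p where "p n = mat (s ^ n) + mat (of_nat n * s ^ (n - 1)) ** N" for n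
  have p0: "p 0 = mat 1"
    by (simp add: p_def mat2_simps)
  have pS: "p (Suc n) = (mat s + N) ** p n" for n
  proof -
    have e: "(mat s + N) ** (mat a + mat b ** N) = mat (s * a) + mat (a + s * b) ** N" for a b
    proof -
      have "(mat s + N) ** (mat a + mat b ** N) =
        mat (s * a) + mat (a + s * b) ** N + mat b ** (N ** N)"
        by (simp add: mat2_simps algebra_simps)
      then show ?thesis by (simp add: N)
    qed
    show ?thesis unfolding p_def e
      by (cases n) (simp_all add: algebra_simps)
  qed
  have pG: "p n \<in> G" for n
    by (induction n) (auto simp: p0 pS one_closed mult_closed h)
  have s: "s \<noteq> 0"
  proof
    assume "s = 0"
    then have "N \<in> G" using h by (simp add: mat_0)
    then have "det N \<noteq> 0" by (rule det_nonzero)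
    moreover have "det N * det N = det (N ** N)"
      by (simp add: det_mul)
    then have "det N * det N = 0"
      by (simp add: N det_2)
    ultimately show False by simp
  qed
  have "inj p"
  proof (rule injI)
    fix m n assume eq: "p m = p n"
    let ?a = "\<lambda>n. (of_nat n * s ^ (n - 1) :: complex)"
    \<comment> \<open>Multiplying by \<open>N\<close> kills the nilpotent term, so the scalar parts
      can be compared first and the coefficients of \<open>N\<close> afterwards.\<close>
    have "(p m - p n) ** N = mat (s ^ m - s ^ n) ** N + mat (?a m - ?a n) ** (N ** N)"
      by (simp add: p_def mat2_simps algebra_simps)
    then have "mat (s ^ m - s ^ n) ** N = 0" using eq N by simp
    then have 1: "s ^ m = s ^ n"
      using \<open>N \<noteq> 0\<close> by (auto simp: mat2_simps)
    then have "mat (?a m - ?a n) ** N = 0"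
      using eq by (simp add: p_def mat2_simps algebra_simps)
    then have 2: "?a m = ?a n"
      using \<open>N \<noteq> 0\<close> by (auto simp: mat2_simps)
    \<comment> \<open>The truncated exponent at \<open>n = 0\<close> is harmless because it comes
      with the factor 0.\<close>
    have 3: "s * ?a n = of_nat n * s ^ n" for n
      by (cases n) auto
    have "of_nat m * s ^ m = of_nat n * s ^ n"
      using 2 3 by metis
    then show "m = n" using 1 s by simp
  qed
  then have "infinite (range p)" by (simp add: range_inj_infinite)
  moreover have "range p \<subseteq> G" using pG by auto
  ultimately show False using finite finite_subset by blast
qed

section \<open>Centralizers, eigenline exchanges and the count of conjugates\<close>

definition centralizer :: "mat2 \<Rightarrow> mat2 set" where
  "centralizer h = {x \<in> G. x ** h = h ** x}"

definition scalars :: "mat2 set" where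
  "scalars = {z \<in> G. scalar_mat z}"

definition noncentral_conjugates :: "mat2 \<Rightarrow> mat2 set" where
  "noncentral_conjugates h =
    (\<lambda>(x, a). x ** a ** matrix_inv x) ` (G \<times> (centralizer h - scalars))"

definition traceless_part :: "mat2 \<Rightarrow> mat2" where
  "traceless_part h = h - mat (trace h / 2)"

text \<open>For a nonscalar \<open>h\<close> in \<open>G\<close> the matrix
  \<open>traceless_part h\<close> has the eigenlines of \<open>h\<close>, with two opposite nonzero
  eigenvalues. The elements defined here are those that exchange the two eigenlines.\<close>

definition anticommuting :: "mat2 \<Rightarrow> mat2 set" where
  "anticommuting h = {n \<in> G. n ** traceless_part h = - (traceless_part h ** n)}"

text \<open>Elements of a finite group are diagonalizable: with determinant 0, the traceless part
  would have square 0 by Cayley-Hamilton, hence vanish, and \<open>h\<close> would be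
  scalar.\<close>

lemma det_traceless_part_nonzero:
  assumes h: "h \<in> G" "\<not> scalar_mat h"
  shows "det (traceless_part h) \<noteq> 0"
proof
  let ?k = "traceless_part h"
  assume "det ?k = 0"
  moreover have "trace ?k = 0"
    by (simp add: traceless_part_def mat2_simps)
  ultimately have "?k ** ?k = 0"
    by (simp add: cayley_hamilton_2 mat_0)
  moreover have "mat (trace h / 2) + ?k \<in> G"
    using h by (simp add: traceless_part_def)
  ultimately have "?k = 0"
    by (rule nilpotent_part_zero[rotated])
  with h show False
    by (auto simp: traceless_part_def scalar_mat_def)
qed

lemma centralizer_eq_traceless_part:
  "centralizer h = {x \<in> G. x ** traceless_part h = traceless_part h ** x}"
  by (auto simp: centralizer_def traceless_part_def mat2_simps algebra_simps)

text \<open>As \<open>s\<close> is nonzero, \<open>h\<close> is in turn an affine function of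
  \<open>a\<close>, so statements about commuting with or conjugating \<open>a\<close> carry over to
  \<open>h\<close>.\<close>

lemma noncentral_conjugateE:
  assumes "a \<in> centralizer h - scalars" "\<not> scalar_mat h"
  obtains s t where "a = mat s ** h + mat t" "s \<noteq> 0"
proof -
  from assms obtain s t where st: "a = mat s ** h + mat t"
    using commuting_nonscalar[of a h] by (auto simp: centralizer_def)
  moreover from assms st have "s \<noteq> 0"
    by (auto simp: centralizer_def scalars_def scalar_mat_def mat_0)
  ultimately show ?thesis using that by blast
qed

text \<open>Both \<open>a\<close> and \<open>b\<close> are affine functions of \<open>h\<close>, so
  conjugation by \<open>n\<close> sends the traceless part \<open>k\<close> of \<open>h\<close> to
  some \<open>c k + d\<close>. Invariance of the trace forces \<open>d = 0\<close>, and invariance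
  of the determinant forces \<open>c\<close> to be 1 or -1.\<close>

lemma conjugating_centralizer:
  assumes h: "h \<in> G" "\<not> scalar_mat h"
    and a: "a \<in> centralizer h - scalars" "b \<in> centralizer h - scalars"
    and n: "n \<in> G" "n ** a = b ** n"
  shows "n \<in> centralizer h \<union> anticommuting h"
proof -
  obtain s t where a': "a = mat s ** h + mat t" "s \<noteq> 0"
    using noncentral_conjugateE[OF a(1) h(2)] by blast
  obtain s' t' where b': "b = mat s' ** h + mat t'" "s' \<noteq> 0"
    using noncentral_conjugateE[OF a(2) h(2)] by blast
  define k where "k = traceless_part h"
  \<comment> \<open>These constants result from writing \<open>h\<close> as \<open>k\<close> plus a
    scalar in \<open>n ** a = b ** n\<close> and solving for \<open>n ** k\<close>.\<close>
  define c where "c = s' / s"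
  define d where "d = (t' + s' * (trace h / 2) - t - s * (trace h / 2)) / s"
  have "mat s ** (n ** k) - mat s ** (mat c ** k ** n + mat d ** n) = n ** a - b ** n"
    using a' b' by (simp add: k_def traceless_part_def c_def d_def mat2_simps field_simps)
  then have "mat s ** (n ** k) = mat s ** (mat c ** k ** n + mat d ** n)"
    by (simp add: n)
  then have nk: "n ** k = mat c ** k ** n + mat d ** n"
    using a'(2) by (simp add: mat2_simps)
  have ninv: "n ** matrix_inv n = mat 1"
    by (simp add: inv_right n)
  have "trace (n ** k ** matrix_inv n) = trace (matrix_inv n ** (n ** k))"
    by (rule trace_mul_sym)
  also have "\<dots> = trace k"
    by (simp add: inv_left_cancel n)
  also have "\<dots> = 0"
    by (simp add: k_def traceless_part_def mat2_simps)
  finally have "trace (n ** k ** matrix_inv n) = 0" .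
  moreover have "n ** k ** matrix_inv n = mat c ** k + mat d"
    unfolding nk by (simp add: mat2_add_mult ninv flip: matrix_mul_assoc)
  ultimately have "trace (mat c ** k + mat d) = 0"
    by simp
  moreover have "trace (mat c ** k + mat d) = 2 * d"
    by (simp add: k_def traceless_part_def mat2_simps field_simps)
  ultimately have d0: "d = 0" by simp
  have "det n * det k = det (mat c :: mat2) * det k * det n"
    using arg_cong[OF nk, of det] by (simp add: d0 mat_0 det_mul)
  moreover have "det k \<noteq> 0"
    using det_traceless_part_nonzero[OF h] by (simp add: k_def)
  moreover have "det (mat c :: mat2) = c\<^sup>2"
    by (simp add: mat2_simps power2_eq_square)
  ultimately have "c\<^sup>2 = 1"
    using det_nonzero[OF n(1)] by simp
  then have "c = 1 \<or> c = -1"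
    by (simp add: power2_eq_1_iff)
  then have "n ** k = k ** n \<or> n ** k = - (k ** n)"
    using nk by (auto simp: d0 mat2_simps)
  then show ?thesis
    using n(1) by (auto simp: centralizer_eq_traceless_part anticommuting_def k_def)
qed

text \<open>The pairs \<open>(x, a)\<close> are counted by the value of the conjugate. If
  \<open>(x0, a0)\<close> and \<open>(x, a)\<close> give the same conjugate, then
  \<open>matrix_inv x0 ** x\<close> conjugates \<open>a\<close> into \<open>a0\<close>, so it
  commutes or anticommutes with the traceless part of \<open>h\<close>. This bounds every
  fibre.\<close>

lemma card_noncentral_conjugates:
  assumes h: "h \<in> G" "\<not> scalar_mat h"
  shows "card G * card (centralizer h - scalars) \<le>
    card (centralizer h \<union> anticommuting h) * card (noncentral_conjugates h)"
proof -
  let ?S = "G \<times> (centralizer h - scalars)"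
  let ?f = "\<lambda>(x, a). x ** a ** matrix_inv x"
  let ?N = "centralizer h \<union> anticommuting h"
  have finS: "finite ?S" and finN: "finite ?N"
    using finite by (auto simp: centralizer_def anticommuting_def)
  have fibre: "card {p \<in> ?S. ?f p = y} \<le> card ?N" if y: "y \<in> ?f ` ?S" for y
  proof -
    from y obtain x0 a0 where x0: "x0 \<in> G" "a0 \<in> centralizer h - scalars"
      and y0: "y = x0 ** a0 ** matrix_inv x0" by auto
    \<comment> \<open>Within a fibre \<open>x\<close> determines \<open>a\<close>, so recording the
      quotient of \<open>x\<close> by \<open>x0\<close> loses nothing.\<close>
    let ?g = "\<lambda>(x, a). matrix_inv x0 ** x"
    have *: "x ** a = y ** x" if "(x, a) \<in> ?S" "?f (x, a) = y" for x a
      using that by (metis (no_types, lifting) inv_left matrix_mul_assoc matrix_mul_rid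
          SigmaD1 case_prod_conv)
    have "inj_on ?g {p \<in> ?S. ?f p = y}"
    proof (rule inj_onI)
      fix p p' assume p: "p \<in> {p \<in> ?S. ?f p = y}" "p' \<in> {p \<in> ?S. ?f p = y}" "?g p = ?g p'"
      obtain x a x' a' where pp: "p = (x, a)" "p' = (x', a')"
        by fastforce
      have xa: "(x, a) \<in> ?S" "(x', a') \<in> ?S" and eq: "?f (x, a) = y" "?f (x', a') = y"
        using p pp by auto
      have "matrix_inv x0 ** x = matrix_inv x0 ** x'"
        using p pp by simp
      then have "x = x'"
        using mult_left_cancel[OF inv_closed[OF x0(1)]] by blast
      moreover have "x ** a = x' ** a'"
        using *[of x a] *[of x' a'] xa eq \<open>x = x'\<close> by simp
      ultimately show "p = p'"
        using mult_left_cancel[of x] xa pp by auto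
    qed
    moreover have "?g ` {p \<in> ?S. ?f p = y} \<subseteq> ?N"
    proof (rule image_subsetI)
      fix p assume p: "p \<in> {p \<in> ?S. ?f p = y}"
      then obtain x a where pp: "p = (x, a)" and x: "x \<in> G" "a \<in> centralizer h" "a \<notin> scalars"
        and y: "y = x ** a ** matrix_inv x" by auto
      have "(matrix_inv x0 ** x) ** a = matrix_inv x0 ** (x ** a)"
        by (simp add: matrix_mul_assoc)
      also have "x ** a = x0 ** (a0 ** (matrix_inv x0 ** x))"
        using *[of x a] x y y0 by (simp add: matrix_mul_assoc)
      finally have "(matrix_inv x0 ** x) ** a = a0 ** (matrix_inv x0 ** x)"
        by (simp add: inv_left_cancel x0)
      then show "?g p \<in> ?N"
        using conjugating_centralizer[OF h, of a a0 "matrix_inv x0 ** x"] x x0 pp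
        by (simp add: inv_closed mult_closed)
    qed
    ultimately show ?thesis
      using card_inj_on_le finN by blast
  qed
  have "card ?S = (\<Sum>y\<in>?f ` ?S. card {p \<in> ?S. ?f p = y})"
    using sum.image_gen[OF finS, of "\<lambda>_. 1::nat" ?f] by simp
  also have "\<dots> \<le> (\<Sum>y\<in>?f ` ?S. card ?N)"
    using fibre by (intro sum_mono) auto
  finally show ?thesis
    by (simp add: card_cartesian_product noncentral_conjugates_def mult.commute)
qed

text \<open>The traceless part \<open>k\<close> of \<open>h\<close> is invertible, and anticommuting
  with it means that \<open>n\<close> is conjugate to \<open>- n\<close>.\<close>

lemma trace_anticommuting:
  assumes h: "h \<in> G" "\<not> scalar_mat h" and n: "n \<in> anticommuting h"
  shows "trace n = 0"
proof -
  let ?k = "traceless_part h"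
  have "invertible ?k"
    using det_traceless_part_nonzero[OF h] by (simp add: invertible_det_nz)
  then obtain l where l: "?k ** l = mat 1" "l ** ?k = mat 1"
    by (auto simp: invertible_def)
  have "n = (n ** ?k) ** l"
    by (simp add: l flip: matrix_mul_assoc)
  also have "\<dots> = - ((?k ** n) ** l)"
    using n by (simp add: anticommuting_def mat2_minus_mult)
  finally have "trace n = - trace ((?k ** n) ** l)"
    by (metis trace_minus)
  also have "trace ((?k ** n) ** l) = trace (l ** (?k ** n))"
    by (rule trace_mul_sym)
  also have "\<dots> = trace n"
    by (simp add: l matrix_mul_assoc)
  finally show ?thesis by simp
qed

text \<open>The signs of two anticommuting elements cancel in their quotient, so a translate of the
  anticommuting set lies in the centralizer.\<close>

lemma card_centralizer_anticommuting:
  "card (centralizer h \<union> anticommuting h) \<le> 2 * card (centralizer h)"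
proof (cases "anticommuting h = {}")
  case True
  then show ?thesis by simp
next
  case False
  then obtain n where n: "n \<in> anticommuting h" by blast
  then have nG: "n \<in> G" by (simp add: anticommuting_def)
  let ?k = "traceless_part h"
  have "matrix_inv n ** m \<in> centralizer h" if m: "m \<in> anticommuting h" for m
  proof -
    have "n ** (?k ** (matrix_inv n ** m)) = (n ** ?k) ** (matrix_inv n ** m)"
      by (simp add: matrix_mul_assoc)
    also have "\<dots> = - (?k ** (n ** (matrix_inv n ** m)))"
      using n by (simp add: anticommuting_def mat2_minus_mult flip: matrix_mul_assoc)
    also have "\<dots> = m ** ?k"
      using m nG by (simp add: anticommuting_def inv_right_cancel)
    finally have "n ** (?k ** (matrix_inv n ** m)) = n ** (matrix_inv n ** m ** ?k)"
      using nG by (simp add: inv_right_cancel flip: matrix_mul_assoc)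
    then have "?k ** (matrix_inv n ** m) = matrix_inv n ** m ** ?k"
      using mult_left_cancel[OF nG] by blast
    moreover have "m \<in> G" using m by (simp add: anticommuting_def)
    ultimately show ?thesis
      using nG by (simp add: centralizer_eq_traceless_part mult_closed inv_closed)
  qed
  then have "(\<lambda>m. matrix_inv n ** m) ` anticommuting h \<subseteq> centralizer h" by blast
  moreover have "inj_on (\<lambda>m. matrix_inv n ** m) (anticommuting h)"
    using mult_left_cancel[OF inv_closed[OF nG]] by (auto simp: inj_on_def)
  moreover have "finite (centralizer h)"
    using finite by (simp add: centralizer_def)
  ultimately have "card (anticommuting h) \<le> card (centralizer h)"
    using card_inj_on_le by blast
  moreover have "card (centralizer h \<union> anticommuting h) \<le> card (centralizer h) + card (anticommuting h)"
    by (rule card_Un_le)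
  ultimately show ?thesis by linarith
qed

end

section \<open>Consequences of the absence of pseudo-reflections\<close>

lemma pseudo_reflection_if_eigenvalue_1:
  assumes g: "g \<noteq> mat 1" and det: "det (g - mat 1) = 0"
  shows "pseudo_reflection g"
proof -
  have "\<not> invertible (g - mat 1)"
    using det by (simp add: invertible_det_nz)
  then have "\<not> (\<exists>B. B ** (g - mat 1) = mat 1)"
    by (simp add: invertible_left_inverse)
  then obtain v where v: "(g - mat 1) *v v = 0" "v \<noteq> 0"
    using matrix_left_invertible_ker by blast
  then have gv: "g *v v = v"
    by (simp add: matrix_vector_mult_diff_rdistrib)
  \<comment> \<open>In dimension 2 a hyperplane is a line, so the span of a single nonzero fixed
    vector is enough.\<close>
  have "vec.subspace (vec.span {v})"
    by (rule vec.subspace_span)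
  moreover have "vec.dim (vec.span {v}) = CARD(2) - 1"
    using v(2) vec.dim_eq_card_independent[of "{v}"] by simp
  moreover have "\<forall>w\<in>vec.span {v}. g *v w = w"
    using gv by (auto simp: vec.span_singleton vector_scalar_commute)
  ultimately show ?thesis
    using g unfolding pseudo_reflection_def by blast
qed

lemma det_minus_mat_1: "det (A - mat 1 :: mat2) = 1 - trace A + det A"
  by (simp add: mat2_simps algebra_simps)

locale small_group = finite_mat_group +
  assumes small: "small G"
begin

text \<open>The expression is the characteristic polynomial of \<open>g\<close> evaluated at
  1.\<close>

lemma no_eigenvalue_1:
  assumes "g \<in> G" "g \<noteq> mat 1"
  shows "1 - trace g + det g \<noteq> 0"
  using assms small pseudo_reflection_if_eigenvalue_1[of g]
  unfolding small_def det_minus_mat_1 by blast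

text \<open>By Cayley-Hamilton \<open>g ** g\<close> is a scalar in \<open>G\<close>, so
  \<open>det g\<close> has square 1. Determinant -1 with trace 0 would give the eigenvalues 1 and
  -1, that is, a reflection.\<close>

lemma det_traceless:
  assumes g: "g \<in> G" "trace g = 0" and Z: "scalars \<subseteq> SL2"
  shows "det g = 1"
proof -
  have "g ** g = mat (- det g)"
    using g by (simp add: cayley_hamilton_2 mat2_simps)
  then have "g ** g \<in> scalars"
    using mult_closed[OF g(1) g(1)] by (auto simp: scalars_def scalar_mat_def)
  then have "det (g ** g) = 1"
    using Z by (auto simp: SL2_def)
  then have "(det g)\<^sup>2 = 1"
    by (simp add: det_mul power2_eq_square)
  moreover have "g \<noteq> mat 1"
    using g by (auto simp: mat2_simps)
  then have "det g \<noteq> -1"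
    using no_eigenvalue_1[OF g(1)] g by auto
  ultimately show ?thesis
    by (auto simp: power2_eq_1_iff)
qed

text \<open>This turns a count of elements modulo scalars into a count of elements: if members of
  \<open>T\<close> are never proportional, all products of \<open>T\<close> with scalars are
  different.\<close>

lemma card_translates_le:
  assumes B: "finite B" and T: "finite T" and sub: "\<And>x z. x \<in> T \<Longrightarrow> z \<in> Z \<Longrightarrow> x ** z \<in> B"
    and TG: "T \<subseteq> G" and indep: "\<And>x y c. x \<in> T \<Longrightarrow> y \<in> T \<Longrightarrow> x = mat c ** y \<Longrightarrow> x = y"
    and Z: "Z \<subseteq> scalars"
  shows "card T * card Z \<le> card B"
proof -
  have "inj_on (\<lambda>(x, z). x ** z) (T \<times> Z)"
  proof (rule inj_onI)
    fix p q assume pq: "p \<in> T \<times> Z" "q \<in> T \<times> Z" "(\<lambda>(x, z). x ** z) p = (\<lambda>(x, z). x ** z) q"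
    obtain x z y w where p: "p = (x, z)" "q = (y, w)" by fastforce
    then have mem: "x \<in> T" "y \<in> T" "z \<in> Z" "w \<in> Z" and eq: "x ** z = y ** w"
      using pq by auto
    obtain c d where cd: "z = mat c" "w = mat d"
      using mem Z by (fastforce simp: scalars_def scalar_mat_def)
    have "det z \<noteq> 0"
      using mem Z det_nonzero by (auto simp: scalars_def)
    then have c: "c \<noteq> 0"
      using cd by (auto simp: mat2_simps)
    have "x = mat (d / c) ** y"
      using eq c unfolding cd by (simp add: mat2_simps field_simps)
    then have "x = y" using indep mem by blast
    then show "p = q"
      using eq mult_left_cancel[of y] mem TG p by auto
  qed
  then have "card (T \<times> Z) \<le> card B"
    using sub B by (intro card_inj_on_le[of "\<lambda>(x, z). x ** z"]) auto
  then show ?thesis by (simp add: card_cartesian_product)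
qed

text \<open>Modulo scalars, the elements \<open>1, g, g\<^sup>2, g\<^sup>3\<close> are different: otherwise \<open>g\<close> or \<open>-g\<close> would be a
  pseudo-reflection, or \<open>g\<close> would have determinant 1.\<close>
lemma card_centralizer_ge_4:
  assumes g: "g \<in> G" "det g \<noteq> 1" and Z: "scalars \<subseteq> SL2"
  shows "4 * card scalars \<le> card (centralizer g)"
proof -
  define t where "t = trace g"
  define d where "d = det g"
  have ns: "\<not> scalar_mat g"
    using g Z by (auto simp: scalars_def SL2_def)
  have t: "t \<noteq> 0"
    using det_traceless[OF g(1) _ Z] g(2) by (auto simp: t_def)
  have d: "d \<noteq> 0"
    using det_nonzero[OF g(1)] by (simp add: d_def)
  have g2: "g ** g = mat t ** g + mat (- d)"
    by (simp add: cayley_hamilton_2 t_def d_def mat2_simps)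
  have g3: "g ** (g ** g) = mat (t\<^sup>2 - d) ** g + mat (- t * d)"
  proof -
    have "g ** (g ** g) = g ** (mat t ** g + mat (- d))"
      by (simp only: g2)
    also have "\<dots> = mat t ** (g ** g) + mat (- d) ** g"
      by (simp add: mat2_simps algebra_simps)
    also have "\<dots> = mat t ** (mat t ** g + mat (- d)) + mat (- d) ** g"
      by (simp only: g2)
    also have "\<dots> = mat (t\<^sup>2 - d) ** g + mat (- t * d)"
      by (simp add: mat2_simps algebra_simps power2_eq_square)
    finally show ?thesis .
  qed
  have g3G: "g ** (g ** g) \<in> G"
    using g by (simp add: mult_closed)
  have g1: "g \<noteq> mat 1"
    using ns by (auto simp: scalar_mat_def)
  \<comment> \<open>Equality would make the cube of \<open>g\<close> the scalar
    \<open>- (t ^ 3)\<close>, and \<open>t ^ 3\<close> would be 1 or -1 because scalars have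
    determinant 1. In the two cases \<open>- g\<close> and \<open>g\<close>, respectively, turn out
    to have the eigenvalue 1.\<close>
  have td: "t\<^sup>2 \<noteq> d"
  proof
    assume td: "t\<^sup>2 = d"
    then have g3': "g ** (g ** g) = mat (- (t ^ 3))"
      using g3 by (simp add: mat_0 power2_eq_square power3_eq_cube mult.assoc flip: td)
    then have "g ** (g ** g) \<in> scalars"
      using g3G by (auto simp: scalars_def scalar_mat_def)
    then have "det (g ** (g ** g)) = 1"
      using Z by (auto simp: SL2_def)
    then have "(t ^ 3)\<^sup>2 = 1"
      unfolding g3' by (simp add: mat2_simps power2_eq_square)
    then consider "t ^ 3 = 1" | "t ^ 3 = - 1"
      unfolding power2_eq_1_iff by blast
    then show False
    proof cases
      case 1
      have "(t - 1) * (1 + t + t\<^sup>2) = 0"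
        using 1 by (simp add: algebra_simps power2_eq_square power3_eq_cube)
      moreover have "t \<noteq> 1"
        using g(2) td by (auto simp: d_def)
      ultimately have "1 + t + d = 0" using td by simp
      \<comment> \<open>Here the cube of \<open>g\<close> is -1, so the fourth power is
        \<open>- g\<close>.\<close>
      moreover have "- g \<in> G"
      proof -
        have "g ** (g ** (g ** g)) \<in> G"
          using g g3G by (simp add: mult_closed)
        moreover have "g ** mat (- 1) = - g"
          by (simp add: mat2_simps)
        ultimately show ?thesis
          unfolding g3' 1 by simp
      qed
      moreover have "- g \<noteq> mat 1"
      proof
        assume "- g = mat 1"
        then have "g = - mat 1" by (metis minus_minus)
        also have "\<dots> = mat (- 1)" by (simp add: mat2_simps)
        finally show False using ns by (auto simp: scalar_mat_def)
      qed
      ultimately show False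
        using no_eigenvalue_1[of "- g"] by (simp add: trace_minus t_def d_def det_2)
    next
      case 2
      have "(t + 1) * (1 - t + t\<^sup>2) = 0"
        using 2 by (simp add: algebra_simps power2_eq_square power3_eq_cube)
      moreover have "t \<noteq> -1"
        using g(2) td by (auto simp: d_def)
      then have "t + 1 \<noteq> 0" by (simp add: eq_neg_iff_add_eq_0)
      ultimately have "1 - t + d = 0" using td mult_eq_0_iff by blast
      then show False
        using no_eigenvalue_1[OF g(1) g1] by (simp add: t_def d_def)
    qed
  qed
  \<comment> \<open>As \<open>g\<close> is not scalar, \<open>g\<close> and the identity are
    linearly independent, so proportional matrices have proportional coefficient pairs.\<close>
  have gen: "a * b' = a' * b"
    if "mat a ** g + mat b = mat c ** (mat a' ** g + mat b')" for a b a' b' c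
  proof -
    have e: "mat (a - c * a') ** g = mat (c * b' - b)"
      using that by (simp add: mat2_simps algebra_simps)
    have "a - c * a' = 0"
    proof (rule ccontr)
      assume "a - c * a' \<noteq> 0"
      then have "g = mat ((c * b' - b) / (a - c * a'))"
        using e by (simp add: mat2_simps field_simps)
      with ns show False by (auto simp: scalar_mat_def)
    qed
    moreover from this e have "c * b' - b = 0" by (auto simp: mat2_simps)
    ultimately show ?thesis by (auto simp: algebra_simps)
  qed
  \<comment> \<open>These are the coefficients of the powers 0 to 3 of \<open>g\<close> with respect
    to \<open>g\<close> and the identity. Their pairwise determinants are, up to sign, 1,
    \<open>t\<close>, \<open>t^2 - d\<close>, \<open>d\<close>, \<open>t * d\<close> and
    \<open>d^2\<close>, all nonzero.\<close>
  define P where "P = {(0, 1), (1, 0), (t, - d), (t\<^sup>2 - d, - t * d)}"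
  define el where "el = (\<lambda>(a, b). mat a ** g + mat b)"
  have indep: "p = q" if "p \<in> P" "q \<in> P" "el p = mat c ** el q" for p q c
  proof -
    have "fst p * snd q = fst q * snd p"
      using gen[of "fst p" "snd p" c "fst q" "snd q"] that(3) by (simp add: el_def split_beta)
    moreover have "d + (t\<^sup>2 - d) \<noteq> 0" using t by simp
    ultimately show ?thesis
      using that(1,2) t d td unfolding P_def
      by (auto simp: power2_eq_square algebra_simps)
  qed
  have elP: "el ` P = {mat 1, g, g ** g, g ** (g ** g)}"
    unfolding P_def el_def g3 unfolding g2 by (simp add: mat_0)
  have sub: "el ` P \<subseteq> centralizer g"
    unfolding elP using g g3G
    by (auto simp: centralizer_def one_closed mult_closed matrix_mul_assoc)
  have inj: "inj_on el P"
    by (rule inj_onI, rule indep[of _ _ 1]) auto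
  have "(t, - d) \<noteq> (t\<^sup>2 - d, - t * d)"
    using d by auto
  then have "card P = 4"
    unfolding P_def using t d td by auto
  then have "card (el ` P) = 4"
    using card_image[OF inj] by simp
  moreover have "card (el ` P) * card scalars \<le> card (centralizer g)"
  proof (rule card_translates_le)
    show "finite (centralizer g)" using finite by (simp add: centralizer_def)
    show "finite (el ` P)" by (simp add: P_def)
    show "el ` P \<subseteq> G" using sub by (auto simp: centralizer_def)
    fix x y c assume "x \<in> el ` P" "y \<in> el ` P" "x = mat c ** y"
    then show "x = y" using indep by blast
  next
    fix x z assume x: "x \<in> el ` P" and z: "z \<in> scalars"
    from x have x': "x \<in> G" "x ** g = g ** x" using sub by (auto simp: centralizer_def)
    have "x ** z ** g = g ** (x ** z)"
      using z x' by (metis (no_types, lifting) scalar_mat_commutes matrix_mul_assoc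
          scalars_def mem_Collect_eq)
    then show "x ** z \<in> centralizer g"
      using z x' by (auto simp: centralizer_def scalars_def mult_closed)
  qed simp
  ultimately show ?thesis by simp
qed

text \<open>The identity and \<open>h\<close> commute with \<open>h\<close> and are different modulo
  scalars.\<close>

lemma card_centralizer_ge_2:
  assumes h: "h \<in> G" "\<not> scalar_mat h"
  shows "2 * card scalars \<le> card (centralizer h)"
proof -
  have ne: "h \<noteq> mat 1" using h by (auto simp: scalar_mat_def)
  have "card {mat 1, h} * card scalars \<le> card (centralizer h)"
  proof (rule card_translates_le)
    show "finite (centralizer h)" using finite by (simp add: centralizer_def)
    fix x y c assume xy: "x \<in> {mat 1, h}" "y \<in> {mat 1, h}" "x = mat c ** y"
    have "x = y" if "x = mat 1" "y = h"
    proof -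
      have "c \<noteq> 0" using xy that by (auto simp: mat2_simps)
      then have "h = mat (1 / c)"
        using xy that by (simp add: mat2_simps field_simps)
      then show ?thesis using h by (auto simp: scalar_mat_def)
    qed
    then show "x = y"
      using xy h by (auto simp: scalar_mat_def)
  next
    fix x z assume "x \<in> {mat 1, h}" and z: "z \<in> scalars"
    moreover have "h ** z ** h = h ** (h ** z)"
      using z scalar_mat_commutes[of z h] by (simp add: scalars_def flip: matrix_mul_assoc)
    ultimately show "x ** z \<in> centralizer h"
      using h scalar_mat_commutes[of z h]
      by (auto simp: centralizer_def scalars_def mult_closed)
  qed (use h in \<open>auto simp: one_closed\<close>)
  then show ?thesis using ne by simp
qed

text \<open>If the centralizer of \<open>h\<close> were contained in \<open>SL2\<close>, the conjugates of the noncentral elements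
  commuting with \<open>h\<close> would fill at least a quarter of \<open>G\<close>, and those of the noncentral elements
  commuting with some \<open>g\<close> of determinant different from 1 at least three quarters of it, disjointly
  and without the identity.\<close>
lemma commuting_det_ne_1:
  assumes nSL: "\<not> G \<subseteq> SL2" and h: "h \<in> G"
  obtains x where "x \<in> G" "x ** h = h ** x" "det x \<noteq> 1"
proof -
  have "\<exists>x\<in>G. x ** h = h ** x \<and> det x \<noteq> 1"
  proof (rule ccontr)
    assume "\<not> ?thesis"
    then have C: "det x = 1" if "x \<in> centralizer h" for x
      using that by (auto simp: centralizer_def)
    obtain g where g: "g \<in> G" "det g \<noteq> 1"
      using nSL by (auto simp: SL2_def)
    have hns: "\<not> scalar_mat h"
      using C[of g] g h scalar_mat_commutes[of h g] by (auto simp: centralizer_def)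
    have Z: "scalars \<subseteq> SL2"
      using C scalar_mat_commutes by (auto simp: scalars_def SL2_def centralizer_def)
    have gns: "\<not> scalar_mat g"
      using g Z by (auto simp: scalars_def SL2_def)
    have finC: "finite (centralizer a)" for a
      using finite by (simp add: centralizer_def)
    have sub: "scalars \<subseteq> centralizer a" for a
      using scalar_mat_commutes by (auto simp: scalars_def centralizer_def)
    have card_diff: "card (centralizer a - scalars) = card (centralizer a) - card scalars"
      "card scalars \<le> card (centralizer a)" for a
      using card_Diff_subset[OF finite_subset[OF sub finC] sub, of a] card_mono[OF finC sub] by auto
    have Gpos: "card G > 0" "card (centralizer g) > 0" "card (centralizer h) > 0"
      using finite finC g h by (auto simp: card_gt_0_iff centralizer_def)
    \<comment> \<open>If \<open>n\<close> exchanges the eigenlines of \<open>g\<close>, so does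
      \<open>n ** g\<close>. Both are traceless and have determinant 1, which would give
      \<open>det g = 1\<close>.\<close>
    have "anticommuting g = {}"
    proof (rule ccontr)
      assume "anticommuting g \<noteq> {}"
      then obtain n where n: "n \<in> anticommuting g" by blast
      then have nG: "n \<in> G" by (simp add: anticommuting_def)
      have "g ** traceless_part g = traceless_part g ** g"
        using g centralizer_eq_traceless_part[of g] by (auto simp: centralizer_def)
      then have "n ** g ** traceless_part g = n ** traceless_part g ** g"
        by (simp flip: matrix_mul_assoc)
      also have "\<dots> = - (traceless_part g ** (n ** g))"
        using n by (simp add: anticommuting_def mat2_minus_mult matrix_mul_assoc)
      finally have "n ** g \<in> anticommuting g"
        using nG g by (simp add: anticommuting_def mult_closed)
      then have "det (n ** g) = 1" "det n = 1"
        using n g nG trace_anticommuting[OF g(1) gns] det_traceless Z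
        by (auto simp: mult_closed)
      then show False using g by (simp add: det_mul)
    qed
    then have "card G * (card (centralizer g) - card scalars) \<le>
        card (centralizer g) * card (noncentral_conjugates g)"
      using card_noncentral_conjugates[OF g(1) gns] by (simp add: card_diff)
    moreover have "3 * card (centralizer g) \<le> 4 * (card (centralizer g) - card scalars)"
      using card_centralizer_ge_4[OF g Z] by simp
    ultimately have "card G * (3 * card (centralizer g)) \<le>
        4 * (card (centralizer g) * card (noncentral_conjugates g))"
      by (smt (verit) mult.left_commute mult_le_mono2 order_trans)
    then have 1: "3 * card G \<le> 4 * card (noncentral_conjugates g)"
      using Gpos by (simp add: mult.left_commute)
    \<comment> \<open>One factor 2 accounts for possible anticommuting elements, the other for the
      scalars being at most half of the centralizer.\<close>
    have "card G * (card (centralizer h) - card scalars) \<le>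
        2 * card (centralizer h) * card (noncentral_conjugates h)"
      using card_noncentral_conjugates[OF h hns] card_centralizer_anticommuting[of h]
      by (metis (no_types, lifting) card_diff(1) mult_le_mono1 order_trans)
    moreover have "card (centralizer h) \<le> 2 * (card (centralizer h) - card scalars)"
      using card_centralizer_ge_2[OF h hns] by simp
    ultimately have "card G * card (centralizer h) \<le>
        2 * (2 * card (centralizer h) * card (noncentral_conjugates h))"
      by (smt (verit) mult.left_commute mult_le_mono2 order_trans)
    then have 2: "card G \<le> 4 * card (noncentral_conjugates h)"
      using Gpos by simp
    \<comment> \<open>A common element would yield a conjugate \<open>q\<close> of \<open>g\<close>
      that commutes with \<open>h\<close>. Then \<open>det g = det q = 1\<close>, contrary to the
      choice of \<open>g\<close>.\<close>
    have disj: "noncentral_conjugates g \<inter> noncentral_conjugates h = {}"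
    proof (rule ccontr)
      assume "\<not> ?thesis"
      then obtain x a y b where xy: "x \<in> G" "y \<in> G"
        and a: "a \<in> centralizer g - scalars" and b: "b \<in> centralizer h - scalars"
        and eq: "x ** a ** matrix_inv x = y ** b ** matrix_inv y"
        by (auto simp: noncentral_conjugates_def)
      obtain s t where st: "a = mat s ** g + mat t" "s \<noteq> 0"
        using noncentral_conjugateE[OF a gns] by blast
      define n where "n = matrix_inv y ** x"
      have nG: "n \<in> G" using xy by (simp add: n_def mult_closed inv_closed)
      have "x ** a = x ** a ** matrix_inv x ** x"
        using xy by (simp add: inv_left flip: matrix_mul_assoc)
      also have "\<dots> = y ** (b ** n)"
        unfolding eq n_def by (simp add: matrix_mul_assoc)
      finally have na: "n ** a = b ** n"
        using xy by (simp add: n_def inv_left_cancel flip: matrix_mul_assoc)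
      define q where "q = n ** g ** matrix_inv n"
      have qn: "q ** n = n ** g"
        using nG by (simp add: q_def inv_left flip: matrix_mul_assoc)
      have "(mat s ** q + mat t) ** n = mat s ** (q ** n) + mat t ** n"
        by (simp add: mat2_add_mult matrix_mul_assoc)
      also have "\<dots> = n ** a"
        unfolding qn st by (simp add: mat2_simps algebra_simps)
      finally have "mat s ** q + mat t = b"
        using iffD1[OF mult_right_cancel[OF nG]] na by metis
      moreover have "b ** h = h ** b"
        using b by (simp add: centralizer_def)
      ultimately have "(mat s ** q + mat t) ** h = h ** (mat s ** q + mat t)"
        by simp
      then have "mat s ** (q ** h) = mat s ** (h ** q)"
        by (simp add: mat2_simps algebra_simps)
      then have "q ** h = h ** q"
        using st(2) by (simp add: mat2_simps)
      moreover have "q \<in> G"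
        using nG g by (simp add: q_def mult_closed inv_closed)
      ultimately have "det q = 1"
        using C by (simp add: centralizer_def)
      then have "det n * 1 = det n * det g"
        using arg_cong[OF qn, of det] by (simp add: det_mul)
      then show False
        using det_nonzero[OF nG] g by simp
    qed
    \<comment> \<open>The two lower bounds only add up to \<open>card G\<close>; the contradiction
      comes from the identity, which neither set contains.\<close>
    have conj_sub: "noncentral_conjugates a \<subseteq> G - {mat 1}" for a
    proof -
      have "x ** b ** matrix_inv x \<noteq> mat 1" if "x \<in> G" "b \<in> G" "b \<notin> scalars" for x b
      proof
        assume "x ** b ** matrix_inv x = mat 1"
        then have "x ** b ** matrix_inv x = x ** mat 1 ** matrix_inv x"
          using that by (simp add: inv_right)
        then have "b = mat 1"
          using that mult_left_cancel mult_right_cancel[OF inv_closed] by blast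
        then show False using that by (auto simp: scalars_def scalar_mat_def)
      qed
      then show ?thesis
        by (auto simp: noncentral_conjugates_def centralizer_def mult_closed inv_closed)
    qed
    have "card (noncentral_conjugates g) + card (noncentral_conjugates h) =
        card (noncentral_conjugates g \<union> noncentral_conjugates h)"
      using finite_subset[OF conj_sub] finite disj by (intro card_Un_disjoint[symmetric]) auto
    also have "\<dots> \<le> card (G - {mat 1})"
      using conj_sub finite by (intro card_mono) auto
    also have "\<dots> < card G"
      using one_closed finite by (simp add: Gpos)
    finally show False using 1 2 by linarith
  qed
  then show thesis using that by blast
qed

end

section \<open>Skew group algebras\<close>

lemma matrix_inv_one: "matrix_inv (mat 1 :: mat2) = mat 1"
proof -
  have "\<exists>B :: mat2. mat 1 ** B = mat 1 \<and> B ** mat 1 = mat 1"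
    by (rule exI[of _ "mat 1"]) simp
  from someI_ex[OF this] show ?thesis
    by (simp add: matrix_inv_def)
qed

context finite_mat_group
begin

lemma matrix_inv_mult:
  assumes "a \<in> G" "b \<in> G"
  shows "matrix_inv (a ** b) = matrix_inv b ** matrix_inv a"
proof -
  have "(a ** b) ** (matrix_inv b ** matrix_inv a) = a ** (b ** (matrix_inv b ** matrix_inv a))"
    by (rule matrix_mul_assoc[symmetric])
  also have "\<dots> = mat 1"
    by (simp only: inv_right_cancel[OF assms(2)] inv_right[OF assms(1)])
  also have "\<dots> = (a ** b) ** matrix_inv (a ** b)"
    by (rule inv_right[OF mult_closed[OF assms], symmetric])
  finally show ?thesis
    by (rule iffD1[OF mult_left_cancel[OF mult_closed[OF assms]], symmetric])
qed

lemma matrix_inv_inv: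
  assumes "a \<in> G"
  shows "matrix_inv (matrix_inv a) = a"
proof -
  have "matrix_inv a ** matrix_inv (matrix_inv a) = matrix_inv a ** a"
    by (simp add: inv_right inv_left inv_closed assms)
  then show ?thesis
    using mult_left_cancel[OF inv_closed[OF assms]] by blast
qed

lemma skew_mult:
  fixes act :: "mat2 \<Rightarrow> 'a::ring_1 \<Rightarrow> 'a"
  shows "(f \<otimes>\<^bsub>skew_group_algebra G act\<^esub> f') k =
    (if k \<in> G then \<Sum>g\<in>G. f g * act g (f' (matrix_inv g ** k)) else 0)"
proof (cases "k \<in> G")
  case True
  have "(\<Sum>(g, h) | g \<in> G \<and> h \<in> G \<and> g ** h = k. f g * act g (f' h)) =
    (\<Sum>g\<in>G. f g * act g (f' (matrix_inv g ** k)))"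
    by (rule sum.reindex_bij_witness[where i = "\<lambda>g. (g, matrix_inv g ** k)" and j = fst])
      (use True in \<open>auto simp: inv_left_cancel inv_right_cancel mult_closed inv_closed\<close>)
  with True show ?thesis by (simp add: skew_group_algebra_def)
next
  case False
  then have "{(g, h). g \<in> G \<and> h \<in> G \<and> g ** h = k} = {}"
    using mult_closed by auto
  then have "(\<Sum>(g, h) | g \<in> G \<and> h \<in> G \<and> g ** h = k. f g * act g (f' h)) = 0"
    by (simp only: sum.empty)
  then show ?thesis using False by (simp add: skew_group_algebra_def)
qed

lemma ring_skew_group_algebra:
  fixes act :: "mat2 \<Rightarrow> 'a::ring_1 \<Rightarrow> 'a"
  assumes act_add: "\<And>g a b. g \<in> G \<Longrightarrow> act g (a + b) = act g a + act g b"
    and act_mult: "\<And>g a b. g \<in> G \<Longrightarrow> act g (a * b) = act g a * act g b"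
    and act_one: "\<And>g. g \<in> G \<Longrightarrow> act g 1 = 1"
    and one_act: "\<And>a. act (mat 1) a = a"
    and act_act: "\<And>g h a. g \<in> G \<Longrightarrow> h \<in> G \<Longrightarrow> act (g ** h) a = act g (act h a)"
  shows "ring (skew_group_algebra G act)"
proof -
  let ?R = "skew_group_algebra G act"
  have act_zero: "act g 0 = 0" if "g \<in> G" for g
    using act_add[OF that, of 0 0] by simp
  have act_inv: "act g (act (matrix_inv g) a) = a" if "g \<in> G" for g a
    using that act_act[of g "matrix_inv g" a, symmetric] by (simp add: inv_right inv_closed one_act)
  have act_sum: "act g (sum f A) = (\<Sum>x\<in>A. act g (f x))" if "g \<in> G"
    for g and f :: "'b \<Rightarrow> 'a" and A
    by (induction A rule: infinite_finite_induct) (auto simp: act_zero act_add that)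
  show ?thesis
  proof (rule ringI)
    show "abelian_group ?R"
    proof (rule abelian_groupI)
      fix x assume "x \<in> carrier ?R"
      then show "\<exists>y\<in>carrier ?R. y \<oplus>\<^bsub>?R\<^esub> x = \<zero>\<^bsub>?R\<^esub>"
        by (intro bexI[of _ "\<lambda>g. - x g"]) (auto simp: skew_group_algebra_def)
    qed (auto simp: skew_group_algebra_def add.assoc add.commute)
    show "Group.monoid ?R"
    proof (rule monoidI)
      have carrier: "f \<in> carrier ?R \<longleftrightarrow> (\<forall>g. g \<notin> G \<longrightarrow> f g = 0)" for f
        by (simp add: skew_group_algebra_def)
      have one: "\<one>\<^bsub>?R\<^esub> g = (if g = mat 1 then 1 else 0)" for g
        by (simp add: skew_group_algebra_def)
      fix x y z
      show "x \<otimes>\<^bsub>?R\<^esub> y \<in> carrier ?R"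
        by (simp add: carrier skew_mult)
      show "x \<otimes>\<^bsub>?R\<^esub> y \<otimes>\<^bsub>?R\<^esub> z = x \<otimes>\<^bsub>?R\<^esub> (y \<otimes>\<^bsub>?R\<^esub> z)"
      proof
        fix k
        show "(x \<otimes>\<^bsub>?R\<^esub> y \<otimes>\<^bsub>?R\<^esub> z) k = (x \<otimes>\<^bsub>?R\<^esub> (y \<otimes>\<^bsub>?R\<^esub> z)) k"
        proof (cases "k \<in> G")
          case k: True
          have "(x \<otimes>\<^bsub>?R\<^esub> y \<otimes>\<^bsub>?R\<^esub> z) k =
            (\<Sum>a\<in>G. \<Sum>u\<in>G. x u * act u (y (matrix_inv u ** a)) * act a (z (matrix_inv a ** k)))"
            using k by (simp add: skew_mult sum_distrib_right)
          also have "\<dots> =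
            (\<Sum>u\<in>G. \<Sum>a\<in>G. x u * act u (y (matrix_inv u ** a)) * act a (z (matrix_inv a ** k)))"
            by (rule sum.swap)
          \<comment> \<open>Substitute \<open>a = u ** v\<close> in the inner sum.\<close>
          also have "\<dots> = (\<Sum>u\<in>G. \<Sum>v\<in>G. x u * act u (y v * act v (z (matrix_inv v ** (matrix_inv u ** k)))))"
          proof (rule sum.cong[OF refl])
            fix u assume u: "u \<in> G"
            show "(\<Sum>a\<in>G. x u * act u (y (matrix_inv u ** a)) * act a (z (matrix_inv a ** k))) =
              (\<Sum>v\<in>G. x u * act u (y v * act v (z (matrix_inv v ** (matrix_inv u ** k)))))"
              by (rule sum.reindex_bij_witness[where i = "\<lambda>v. u ** v" and j = "\<lambda>a. matrix_inv u ** a"])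
                (use u in \<open>auto simp: inv_left_cancel inv_right_cancel mult_closed inv_closed
                  act_mult mult.assoc matrix_inv_mult act_act act_inv matrix_mul_assoc[symmetric]\<close>)
          qed
          also have "\<dots> = (x \<otimes>\<^bsub>?R\<^esub> (y \<otimes>\<^bsub>?R\<^esub> z)) k"
            using k by (simp add: skew_mult act_sum sum_distrib_left mult_closed inv_closed)
          finally show ?thesis .
        qed (simp add: skew_mult)
      qed
      show "\<one>\<^bsub>?R\<^esub> \<in> carrier ?R"
        using one_closed by (auto simp: skew_group_algebra_def)
      assume x: "x \<in> carrier ?R"
      have x0: "x k = 0" if "k \<notin> G" for k
        using x that by (simp add: carrier)
      show "\<one>\<^bsub>?R\<^esub> \<otimes>\<^bsub>?R\<^esub> x = x"
      proof
        fix k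
        have "(\<Sum>g\<in>G. \<one>\<^bsub>?R\<^esub> g * act g (x (matrix_inv g ** k))) =
          (\<Sum>g\<in>G. if g = mat 1 then x k else 0)"
          by (rule sum.cong) (auto simp: one one_act matrix_inv_one)
        then show "(\<one>\<^bsub>?R\<^esub> \<otimes>\<^bsub>?R\<^esub> x) k = x k"
          using x0 one_closed finite by (simp add: skew_mult)
      qed
      show "x \<otimes>\<^bsub>?R\<^esub> \<one>\<^bsub>?R\<^esub> = x"
      proof
        fix k
        have "x g * act g (\<one>\<^bsub>?R\<^esub> (matrix_inv g ** k)) = (if g = k then x k else 0)"
          if "k \<in> G" "g \<in> G" for g
        proof -
          have "matrix_inv g ** k = mat 1 \<longleftrightarrow> g = k"
            using mult_left_cancel[OF that(2), of "matrix_inv g ** k" "mat 1"] that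
            by (auto simp: inv_right_cancel)
          then show ?thesis using that by (simp add: one act_one act_zero)
        qed
        then show "(x \<otimes>\<^bsub>?R\<^esub> \<one>\<^bsub>?R\<^esub>) k = x k"
          using x0 finite by (simp add: skew_mult cong: sum.cong)
      qed
    qed
  next
    fix x y z
    have add: "(x \<oplus>\<^bsub>?R\<^esub> y) g = x g + y g" for x y g
      by (simp add: skew_group_algebra_def)
    show "(x \<oplus>\<^bsub>?R\<^esub> y) \<otimes>\<^bsub>?R\<^esub> z = x \<otimes>\<^bsub>?R\<^esub> z \<oplus>\<^bsub>?R\<^esub> y \<otimes>\<^bsub>?R\<^esub> z"
      by (rule ext) (simp add: skew_mult add distrib_right sum.distrib)
    show "z \<otimes>\<^bsub>?R\<^esub> (x \<oplus>\<^bsub>?R\<^esub> y) = z \<otimes>\<^bsub>?R\<^esub> x \<oplus>\<^bsub>?R\<^esub> z \<otimes>\<^bsub>?R\<^esub> y"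
      by (rule ext) (simp add: skew_mult add act_add distrib_left sum.distrib cong: sum.cong)
  qed
qed

end

section \<open>The action of matrices on the free algebra\<close>

lemma poly_mapping_sum_single:
  fixes p :: "'a \<Rightarrow>\<^sub>0 'b::comm_monoid_add"
  shows
  "p = (\<Sum>w\<in>Poly_Mapping.keys p. Poly_Mapping.single w (Poly_Mapping.lookup p w))"
  by (rule poly_mapping_eqI) (auto simp: lookup_sum lookup_single when_def not_in_keys_iff_lookup_eq_zero)

lemma poly_mapping_single_add_induct [case_names zero single add]:
  fixes p :: "'a \<Rightarrow>\<^sub>0 'b::comm_monoid_add"
  assumes "P 0" and "\<And>w c. P (Poly_Mapping.single w c)" and "\<And>p q. P p \<Longrightarrow> P q \<Longrightarrow> P (p + q)"
  shows "P p"
proof -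
  have "P (\<Sum>w\<in>A. Poly_Mapping.single w (Poly_Mapping.lookup p w))" for A
    by (induction A rule: infinite_finite_induct) (simp_all add: assms)
  then show ?thesis by (subst poly_mapping_sum_single)
qed

abbreviation scal :: "complex \<Rightarrow> tensor" where
  "scal c \<equiv> Poly_Mapping.single [] c"

lemma scal_mult_single: "scal c * Poly_Mapping.single w d = Poly_Mapping.single w (c * d)"
  by (simp add: mult_single plus_list_def)

lemma scal_one: "scal 1 = 1"
  by (metis single_one zero_list_def)

lemma scal_commute: "scal c * p = p * scal c"
  by (induction p rule: poly_mapping_single_add_induct)
    (simp_all add: mult_single plus_list_def distrib_left distrib_right mult.commute)

lemma lookup_scal_mult: "Poly_Mapping.lookup (scal c * p) w = c * Poly_Mapping.lookup p w"
  by (induction p rule: poly_mapping_single_add_induct)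
    (auto simp: scal_mult_single distrib_left lookup_add lookup_single when_def)

text \<open>The \<open>i\<close>-th coordinate functional composed with the inverse of
  \<open>g\<close> has the \<open>i\<close>-th row of that inverse as its coefficients.\<close>

definition letter_act :: "mat2 \<Rightarrow> 2 \<Rightarrow> tensor" where
  "letter_act g i = (\<Sum>j\<in>UNIV. Poly_Mapping.single [j] (matrix_inv g $ i $ j))"

definition word_act :: "mat2 \<Rightarrow> 2 list \<Rightarrow> tensor" where
  "word_act g w = prod_list (map (letter_act g) w)"

lemma word_act_append: "word_act g (v @ w) = word_act g v * word_act g w"
  by (simp add: word_act_def)

text \<open>The freedom in \<open>A\<close> allows tensors with different supports to be summed over
  one index set, which makes additivity immediate.\<close>

lemma tensor_act_eq:
  assumes "finite A" "Poly_Mapping.keys p \<subseteq> A"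
  shows "tensor_act g p = (\<Sum>w\<in>A. scal (Poly_Mapping.lookup p w) * word_act g w)"
proof -
  have "tensor_of_dual (dual_act g (\<lambda>v. v $ i)) = letter_act g i" for i
    by (simp add: tensor_of_dual_def dual_act_def letter_act_def matrix_vector_mult_def axis_def
        if_distrib cong: if_cong)
  then have "tensor_act g p =
      (\<Sum>w\<in>Poly_Mapping.keys p. scal (Poly_Mapping.lookup p w) * word_act g w)"
    by (simp add: tensor_act_def word_act_def)
  also have "\<dots> = (\<Sum>w\<in>A. scal (Poly_Mapping.lookup p w) * word_act g w)"
    using assms by (intro sum.mono_neutral_left) (auto simp: not_in_keys_iff_lookup_eq_zero)
  finally show ?thesis .
qed

lemma tensor_act_single: "tensor_act g (Poly_Mapping.single w c) = scal c * word_act g w"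
  using tensor_act_eq[of "{w}" "Poly_Mapping.single w c" g] by simp

lemma tensor_act_add: "tensor_act g (p + q) = tensor_act g p + tensor_act g q"
proof -
  let ?A = "Poly_Mapping.keys p \<union> Poly_Mapping.keys q"
  have "tensor_act g r = (\<Sum>w\<in>?A. scal (Poly_Mapping.lookup r w) * word_act g w)"
    if "r \<in> {p, q, p + q}" for r
    using that keys_add[of p q] by (intro tensor_act_eq) auto
  then show ?thesis
    by (simp add: lookup_add single_add distrib_right sum.distrib)
qed

lemma tensor_act_zero: "tensor_act g 0 = 0"
  using tensor_act_add[of g 0 0] by simp

lemma tensor_act_sum: "tensor_act g (sum f A) = (\<Sum>x\<in>A. tensor_act g (f x))"
  by (induction A rule: infinite_finite_induct) (simp_all add: tensor_act_add tensor_act_zero)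

lemma tensor_act_mult: "tensor_act g (p * q) = tensor_act g p * tensor_act g q"
proof (induction p rule: poly_mapping_single_add_induct)
  case (single v c)
  show ?case
  proof (induction q rule: poly_mapping_single_add_induct)
    case (single w d)
    have "tensor_act g (Poly_Mapping.single v c * Poly_Mapping.single w d) =
        (scal c * scal d) * (word_act g v * word_act g w)"
      by (simp only: mult_single plus_list_def tensor_act_single word_act_append append_Nil)
    also have "\<dots> = scal c * (scal d * word_act g v) * word_act g w"
      by (simp only: mult.assoc)
    also have "scal d * word_act g v = word_act g v * scal d"
      by (rule scal_commute)
    finally show ?case
      by (simp add: tensor_act_single mult.assoc)
  qed (simp_all add: tensor_act_add tensor_act_zero distrib_left)
qed (simp_all add: tensor_act_add tensor_act_zero distrib_right)

lemma tensor_act_scal: "tensor_act g (scal c) = scal c"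
  by (simp add: tensor_act_single word_act_def)

lemma tensor_act_one: "tensor_act g 1 = 1"
  using tensor_act_scal[of g 1] by (simp add: scal_one)

lemma tensor_act_scal_mult: "tensor_act g (scal c * p) = scal c * tensor_act g p"
  by (simp add: tensor_act_mult tensor_act_scal)

lemma tensor_act_prod_list: "tensor_act g (prod_list xs) = prod_list (map (tensor_act g) xs)"
  by (induction xs) (simp_all add: tensor_act_mult tensor_act_one)

lemma tensor_act_letter: "tensor_act g (Poly_Mapping.single [i] c) = scal c * letter_act g i"
  by (simp add: tensor_act_single word_act_def)

lemma prod_list_letters: "prod_list (map (\<lambda>i. Poly_Mapping.single [i] 1) w) = (Poly_Mapping.single w 1 :: tensor)"
  by (induction w) (simp_all add: mult_single plus_list_def scal_one)

lemma tensor_act_mat_1: "tensor_act (mat 1) p = p"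
proof -
  have "letter_act (mat 1) i = Poly_Mapping.single [i] 1" for i
    unfolding letter_act_def matrix_inv_one
    by (simp add: mat_def if_distrib[of "Poly_Mapping.single _"] cong: if_cong)
  then have "word_act (mat 1) w = Poly_Mapping.single w 1" for w
    by (simp add: word_act_def prod_list_letters cong: map_cong)
  then show ?thesis
    by (induction p rule: poly_mapping_single_add_induct)
      (simp_all add: tensor_act_zero tensor_act_add tensor_act_single scal_mult_single)
qed

lemma keys_word_act: "u \<in> Poly_Mapping.keys (word_act g w) \<Longrightarrow> length u = length w"
proof (induction w arbitrary: u)
  case Nil
  then show ?case by (simp add: word_act_def zero_list_def)
next
  case (Cons i w)
  from Cons.prems have "u \<in> Poly_Mapping.keys (letter_act g i * word_act g w)"
    by (simp add: word_act_def)
  then obtain a b where ab: "a \<in> Poly_Mapping.keys (letter_act g i)"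
      "b \<in> Poly_Mapping.keys (word_act g w)" "u = a @ b"
    using keys_mult[of "letter_act g i" "word_act g w"] by (auto simp: plus_list_def)
  have "Poly_Mapping.keys (letter_act g i) \<subseteq> (\<Union>j. {[j]})"
    unfolding letter_act_def by (rule order_trans[OF keys_sum]) auto
  then have "length a = 1" using ab by auto
  then show ?case using ab Cons.IH by simp
qed

lemma keys_tensor_act:
  assumes "u \<in> Poly_Mapping.keys (tensor_act g p)"
  obtains w where "w \<in> Poly_Mapping.keys p" "length u = length w"
proof -
  have "tensor_act g p =
      (\<Sum>w\<in>Poly_Mapping.keys p. scal (Poly_Mapping.lookup p w) * word_act g w)"
    by (rule tensor_act_eq) auto
  then obtain w where w: "w \<in> Poly_Mapping.keys p"
      "u \<in> Poly_Mapping.keys (scal (Poly_Mapping.lookup p w) * word_act g w)"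
    using assms keys_sum by fastforce
  then have "u \<in> Poly_Mapping.keys (word_act g w)"
    by (auto simp: in_keys_iff lookup_scal_mult)
  then show thesis using that w keys_word_act by blast
qed

context finite_mat_group
begin

text \<open>On letters the rows of the inverses multiply in the order of
  \<open>matrix_inv (g ** h)\<close>, so the inverse in \<open>dual_act\<close> yields a left
  action. Multiplicativity extends this to words.\<close>

lemma tensor_act_act:
  assumes "g \<in> G" "h \<in> G"
  shows "tensor_act (g ** h) p = tensor_act g (tensor_act h p)"
proof -
  have letter: "tensor_act g (letter_act h i) = letter_act (g ** h) i" for i
  proof -
    have "tensor_act g (letter_act h i) =
        (\<Sum>j\<in>UNIV. \<Sum>l\<in>UNIV. Poly_Mapping.single [l] (matrix_inv h $ i $ j * matrix_inv g $ j $ l))"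
      by (simp add: letter_act_def tensor_act_sum tensor_act_letter sum_distrib_left scal_mult_single)
    also have "\<dots> = (\<Sum>l\<in>UNIV. \<Sum>j\<in>UNIV.
        Poly_Mapping.single [l] (matrix_inv h $ i $ j * matrix_inv g $ j $ l))"
      by (rule sum.swap)
    also have "\<dots> = letter_act (g ** h) i"
      using assms by (simp add: letter_act_def matrix_inv_mult mat2_mult_nth sum_2 single_add)
    finally show ?thesis .
  qed
  show ?thesis
  proof (induction p rule: poly_mapping_single_add_induct)
    case (single w c)
    have "tensor_act g (word_act h w) = word_act (g ** h) w"
      by (simp add: word_act_def tensor_act_prod_list letter comp_def)
    then show ?case
      by (simp add: tensor_act_single tensor_act_scal_mult)
  qed (simp_all add: tensor_act_add tensor_act_zero)
qed

lemma ring_TSV: "ring (TSV G)"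
  unfolding TSV_def
  by (rule ring_skew_group_algebra)
    (simp_all add: tensor_act_add tensor_act_mult tensor_act_one tensor_act_mat_1 tensor_act_act)

end

section \<open>The ring \<open>TSV G\<close> and products with group elements\<close>

context finite_mat_group
begin

interpretation TSV: ring "TSV G"
  by (rule ring_TSV)

lemma carrier_TSV: "t \<in> carrier (TSV G) \<longleftrightarrow> (\<forall>g. g \<notin> G \<longrightarrow> t g = 0)"
  by (simp add: TSV_def skew_group_algebra_def)

lemma add_TSV: "(s \<oplus>\<^bsub>TSV G\<^esub> t) g = s g + t g"
  by (simp add: TSV_def skew_group_algebra_def)

lemma zero_TSV: "\<zero>\<^bsub>TSV G\<^esub> g = 0"
  by (simp add: TSV_def skew_group_algebra_def)

lemma one_TSV: "\<one>\<^bsub>TSV G\<^esub> g = (if g = mat 1 then 1 else 0)"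
  by (simp add: TSV_def skew_group_algebra_def)

lemma mult_TSV: "(s \<otimes>\<^bsub>TSV G\<^esub> t) k =
  (if k \<in> G then \<Sum>g\<in>G. s g * tensor_act g (t (matrix_inv g ** k)) else 0)"
  by (simp add: TSV_def skew_mult)

lemma uminus_TSV:
  assumes "t \<in> carrier (TSV G)"
  shows "(\<ominus>\<^bsub>TSV G\<^esub> t) g = - t g"
proof -
  have "\<ominus>\<^bsub>TSV G\<^esub> t = (\<lambda>g. - t g)"
    using assms by (intro TSV.minus_equality) (auto simp: carrier_TSV add_TSV zero_TSV fun_eq_iff)
  then show ?thesis by simp
qed

lemma minus_TSV:
  assumes "s \<in> carrier (TSV G)" "t \<in> carrier (TSV G)"
  shows "(s \<ominus>\<^bsub>TSV G\<^esub> t) g = s g - t g"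
  using assms by (simp add: TSV.minus_eq add_TSV uminus_TSV)

definition group_elt :: "mat2 \<Rightarrow> complex \<Rightarrow> mat2 \<Rightarrow> tensor" where
  "group_elt g c = (\<lambda>h. if h = g then scal c else 0)"

lemma group_elt_mem: "g \<in> G \<Longrightarrow> group_elt g c \<in> group_alg G"
  by (auto simp: group_elt_def TSV_degree_def carrier_TSV)

lemma group_elt_mult:
  assumes "g \<in> G" "k \<in> G"
  shows "(group_elt g c \<otimes>\<^bsub>TSV G\<^esub> t) k = scal c * tensor_act g (t (matrix_inv g ** k))"
proof -
  have "(\<Sum>h\<in>G. group_elt g c h * tensor_act h (t (matrix_inv h ** k))) =
    (\<Sum>h\<in>G. if h = g then scal c * tensor_act g (t (matrix_inv g ** k)) else 0)"
    by (rule sum.cong) (auto simp: group_elt_def)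
  then show ?thesis
    using assms finite by (simp add: mult_TSV)
qed

lemma mult_group_elt:
  assumes "g \<in> G" "k \<in> G"
  shows "(t \<otimes>\<^bsub>TSV G\<^esub> group_elt g c) k = t (k ** matrix_inv g) * scal c"
proof -
  have "t h * tensor_act h (group_elt g c (matrix_inv h ** k)) =
      (if h = k ** matrix_inv g then t (k ** matrix_inv g) * scal c else 0)" if h: "h \<in> G" for h
  proof -
    have "matrix_inv h ** k = g \<longleftrightarrow> h = k ** matrix_inv g"
    proof
      assume "matrix_inv h ** k = g"
      then have "h ** g = k" using h by (auto simp: inv_right_cancel)
      then show "h = k ** matrix_inv g"
        using assms inv_right by (auto simp flip: matrix_mul_assoc)
    next
      assume "h = k ** matrix_inv g"
      then have "h ** g = k"
        using assms inv_left by (auto simp flip: matrix_mul_assoc)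
      then show "matrix_inv h ** k = g"
        using h by (auto simp: inv_left_cancel)
    qed
    then show ?thesis
      by (simp add: group_elt_def tensor_act_scal tensor_act_zero)
  qed
  then show ?thesis
    using assms finite by (simp add: mult_TSV mult_closed inv_closed cong: sum.cong)
qed

text \<open>If \<open>g\<close> commutes with \<open>k\<close>, the argument on the right is
  \<open>k\<close> again, so conjugation acts on the coefficient at \<open>k\<close> alone.\<close>

lemma conj_group_elt:
  assumes "g \<in> G" "k \<in> G"
  shows "(group_elt g 1 \<otimes>\<^bsub>TSV G\<^esub> t \<otimes>\<^bsub>TSV G\<^esub> group_elt (matrix_inv g) 1) k =
    tensor_act g (t (matrix_inv g ** k ** g))"
proof -
  have "(group_elt g 1 \<otimes>\<^bsub>TSV G\<^esub> t \<otimes>\<^bsub>TSV G\<^esub> group_elt (matrix_inv g) 1) k =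
      (group_elt g 1 \<otimes>\<^bsub>TSV G\<^esub> t) (k ** g)"
    using mult_group_elt[OF inv_closed[OF assms(1)] assms(2)] matrix_inv_inv[OF assms(1)]
    by (simp add: scal_one)
  also have "\<dots> = tensor_act g (t (matrix_inv g ** (k ** g)))"
    using group_elt_mult[OF assms(1) mult_closed[OF assms(2,1)]] by (simp add: scal_one)
  finally show ?thesis
    by (simp only: matrix_mul_assoc)
qed

lemma Se_submodule_ideal:
  assumes "ideal M (TSV G)"
  shows "Se_submodule G M"
proof -
  interpret M: ideal M "TSV G" by fact
  show ?thesis
    unfolding Se_submodule_def
    using M.a_subset M.zero_closed M.a_closed M.I_l_closed M.I_r_closed
    by (auto simp: TSV_degree_def)
qed

text \<open>Negatives come from multiplying by the element -1 of the group algebra.\<close>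

lemma Se_submodule_minus:
  assumes M: "Se_submodule G M" and ab: "a \<in> M" "b \<in> M"
  shows "a \<ominus>\<^bsub>TSV G\<^esub> b \<in> M"
proof -
  have carr: "a \<in> carrier (TSV G)" "b \<in> carrier (TSV G)"
    using M ab by (auto simp: Se_submodule_def)
  have "a \<oplus>\<^bsub>TSV G\<^esub> (group_elt (mat 1) (- 1) \<otimes>\<^bsub>TSV G\<^esub> b) \<in> M"
    using M ab group_elt_mem[OF one_closed] unfolding Se_submodule_def by blast
  moreover have "a \<oplus>\<^bsub>TSV G\<^esub> (group_elt (mat 1) (- 1) \<otimes>\<^bsub>TSV G\<^esub> b) = a \<ominus>\<^bsub>TSV G\<^esub> b"
  proof
    fix k
    have "(group_elt (mat 1) (- 1) \<otimes>\<^bsub>TSV G\<^esub> b) k = - b k"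
    proof (cases "k \<in> G")
      case True
      have "scal (- 1) = - 1" by (simp add: single_uminus scal_one)
      then show ?thesis
        using True by (simp add: group_elt_mult one_closed tensor_act_mat_1 matrix_inv_one)
    next
      case False
      then show ?thesis using carr by (simp add: mult_TSV carrier_TSV)
    qed
    then show "(a \<oplus>\<^bsub>TSV G\<^esub> (group_elt (mat 1) (- 1) \<otimes>\<^bsub>TSV G\<^esub> b)) k = (a \<ominus>\<^bsub>TSV G\<^esub> b) k"
      using carr by (simp add: add_TSV minus_TSV)
  qed
  ultimately show ?thesis by simp
qed

text \<open>This serves as an upper bound for the ideal I(R): whatever lies in I(R) has no part of
  degree 0 or 1.\<close>

definition order_ge_2 :: "(mat2 \<Rightarrow> tensor) set" where
  "order_ge_2 = {t \<in> carrier (TSV G). \<forall>g. \<forall>w\<in>Poly_Mapping.keys (t g). 2 \<le> length w}"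

lemma ideal_order_ge_2: "ideal order_ge_2 (TSV G)"
proof (rule idealI)
  show "ring (TSV G)" by (rule ring_TSV)
  show "subgroup order_ge_2 (add_monoid (TSV G))"
  proof (rule group.subgroupI)
    show "Group.group (add_monoid (TSV G))" by (rule TSV.a_group)
    show "order_ge_2 \<subseteq> carrier (add_monoid (TSV G))" by (auto simp: order_ge_2_def)
    show "order_ge_2 \<noteq> {}"
      using zero_TSV by (auto simp: order_ge_2_def intro!: exI[of _ "\<zero>\<^bsub>TSV G\<^esub>"])
    fix a b assume a: "a \<in> order_ge_2"
    then have "(\<ominus>\<^bsub>TSV G\<^esub> a) g = - a g" for g by (simp add: order_ge_2_def uminus_TSV)
    then have "\<ominus>\<^bsub>TSV G\<^esub> a \<in> order_ge_2"
      using a by (auto simp: order_ge_2_def in_keys_iff)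
    then show "inv\<^bsub>add_monoid (TSV G)\<^esub> a \<in> order_ge_2"
      unfolding a_inv_def .
    assume b: "b \<in> order_ge_2"
    have "\<forall>w\<in>Poly_Mapping.keys (a g + b g). 2 \<le> length w" for g
      using a b keys_add[of "a g" "b g"] by (auto simp: order_ge_2_def)
    then show "a \<otimes>\<^bsub>add_monoid (TSV G)\<^esub> b \<in> order_ge_2"
      using a b by (auto simp: order_ge_2_def add_TSV)
  qed
next
  fix a x assume a: "a \<in> order_ge_2" and x: "x \<in> carrier (TSV G)"
  \<comment> \<open>The action preserves word lengths, so the lengths of words add up in a
    product.\<close>
  have len: "2 \<le> length w" if "w \<in> Poly_Mapping.keys ((s \<otimes>\<^bsub>TSV G\<^esub> t) k)"
    and st: "s \<in> order_ge_2 \<or> t \<in> order_ge_2" for s t k w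
  proof -
    have "k \<in> G" using that by (auto simp: mult_TSV split: if_splits)
    then have "w \<in> Poly_Mapping.keys (\<Sum>g\<in>G. s g * tensor_act g (t (matrix_inv g ** k)))"
      using that by (simp add: mult_TSV)
    then obtain g where "w \<in> Poly_Mapping.keys (s g * tensor_act g (t (matrix_inv g ** k)))"
      using keys_sum by fastforce
    then obtain u v where u: "u \<in> Poly_Mapping.keys (s g)" and w: "w = u @ v"
      and "v \<in> Poly_Mapping.keys (tensor_act g (t (matrix_inv g ** k)))"
      using keys_mult[of "s g" "tensor_act g (t (matrix_inv g ** k))"]
      by (auto simp: plus_list_def)
    moreover from this(3) obtain v' where v': "v' \<in> Poly_Mapping.keys (t (matrix_inv g ** k))" "length v = length v'"
      by (rule keys_tensor_act)
    have "2 \<le> length u \<or> 2 \<le> length v'"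
      using st u v'(1) by (auto simp: order_ge_2_def)
    then show ?thesis using w v' by auto
  qed
  show "x \<otimes>\<^bsub>TSV G\<^esub> a \<in> order_ge_2"
    using a x len[of _ x a] by (auto simp: order_ge_2_def)
  show "a \<otimes>\<^bsub>TSV G\<^esub> x \<in> order_ge_2"
    using a x len[of _ a x] by (auto simp: order_ge_2_def)
qed

end

section \<open>The commutator that generates the relations\<close>

definition word_commutator :: tensor where
  "word_commutator = Poly_Mapping.single [1, 2] 1 - Poly_Mapping.single [2, 1] 1"

definition plane_commutator :: "mat2 \<Rightarrow> tensor" where
  "plane_commutator = (\<lambda>g. if g = mat 1 then word_commutator else 0)"

text \<open>The commutator is bilinear and alternating on a plane, hence a determinant times its
  value on the two coordinate functionals.\<close>

lemma tensor_of_dual_commutator: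
  "tensor_of_dual x * tensor_of_dual y - tensor_of_dual y * tensor_of_dual x =
    scal (x (axis 1 1) * y (axis 2 1) - x (axis 2 1) * y (axis 1 1)) * word_commutator"
  by (simp add: tensor_of_dual_def sum_2 word_commutator_def algebra_simps mult_single plus_list_def
      flip: single_diff)
    (simp add: single_diff algebra_simps)

lemma plane_commutator_in: "plane_commutator \<in> commutators"
proof -
  have "Vector_Spaces.linear (*s) (*) (\<lambda>v :: complex^2. v $ i)" for i
    by unfold_locales (simp_all add: algebra_simps)
  then have "(\<lambda>v. v $ 1) \<in> dual_space" "(\<lambda>v. v $ 2) \<in> dual_space"
    by (simp_all add: dual_space_def)
  moreover have "tensor_of_dual (\<lambda>v. v $ 1) * tensor_of_dual (\<lambda>v. v $ 2) -
      tensor_of_dual (\<lambda>v. v $ 2) * tensor_of_dual (\<lambda>v. v $ 1) = word_commutator"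
    unfolding tensor_of_dual_commutator by (simp add: axis_def scal_one)
  ultimately show ?thesis
    unfolding commutators_def plane_commutator_def by (force simp: fun_eq_iff)
qed

context finite_mat_group
begin

lemma commutators_subset:
  assumes M: "Se_submodule G M" and c: "plane_commutator \<in> M"
  shows "commutators \<subseteq> M"
proof
  fix r assume "r \<in> commutators"
  then obtain d where r: "r = (\<lambda>g. if g = mat 1 then scal d * word_commutator else 0)"
    unfolding commutators_def tensor_of_dual_commutator by blast
  have "group_elt (mat 1) d \<otimes>\<^bsub>TSV G\<^esub> plane_commutator \<in> M"
    using M c group_elt_mem[OF one_closed] unfolding Se_submodule_def by blast
  moreover have "group_elt (mat 1) d \<otimes>\<^bsub>TSV G\<^esub> plane_commutator = r"
  proof
    fix k
    show "(group_elt (mat 1) d \<otimes>\<^bsub>TSV G\<^esub> plane_commutator) k = r k"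
    proof (cases "k \<in> G")
      case True
      then show ?thesis
        by (simp add: group_elt_mult one_closed tensor_act_mat_1 matrix_inv_one r plane_commutator_def)
    next
      case False
      then show ?thesis using one_closed by (auto simp: mult_TSV r)
    qed
  qed
  ultimately show "r \<in> M" by simp
qed

lemma relations_subset_order_ge_2: "relations G \<subseteq> order_ge_2"
proof -
  have "plane_commutator \<in> order_ge_2"
    using one_closed keys_diff[of "Poly_Mapping.single [1, 2] 1 :: tensor" "Poly_Mapping.single [2, 1] 1"]
    by (auto simp: order_ge_2_def carrier_TSV plane_commutator_def word_commutator_def)
  then show ?thesis
    unfolding relations_def
    using hull_minimal commutators_subset Se_submodule_ideal[OF ideal_order_ge_2] by metis
qed

text \<open>The commutator spans the second exterior power of the dual plane, on which
  \<open>g\<close> acts by the determinant of its inverse.\<close>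

lemma tensor_act_word_commutator:
  assumes "g \<in> G"
  shows "tensor_act g word_commutator = scal (1 / det g) * word_commutator"
proof -
  let ?b = "matrix_inv g"
  have "det g * det ?b = 1"
    using inv_right[OF assms] by (metis det_mul det_I)
  then have d: "1 / det g = det ?b"
    using det_nonzero[OF assms] by (simp add: field_simps)
  have tensor_minus: "tensor_act g (p - q) = tensor_act g p - tensor_act g q" for p q
    using tensor_act_add[of g "p - q" q] by (simp add: algebra_simps)
  show ?thesis
    unfolding word_commutator_def d tensor_minus tensor_act_single
    by (simp add: word_act_def letter_act_def sum_2 det_2 algebra_simps mult_single plus_list_def
      scal_one single_diff)
qed

end

section \<open>Consequences of the PBW property\<close>

lemma (in abelian_subgroup) a_r_coset_eq_iff:
  assumes "x \<in> carrier G" "y \<in> carrier G"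
  shows "H +> x = H +> y \<longleftrightarrow> x \<ominus> y \<in> H"
proof -
  have "x \<ominus> y \<in> H \<longleftrightarrow> x \<in> H +> y"
    using assms by (simp add: a_rcos_module a_minus_def)
  then show ?thesis
    using a_rcos_self[OF assms(1)] a_repr_independence[OF _ assms(2) a_subgroup, of x] by blast
qed

lemma lookup_tensor_component:
  "Poly_Mapping.lookup (tensor_component m p) w = (if length w = m then Poly_Mapping.lookup p w else 0)"
proof -
  have "Poly_Mapping.lookup (tensor_component m p) w =
      (\<Sum>v | v \<in> Poly_Mapping.keys p \<and> length v = m. if v = w then Poly_Mapping.lookup p w else 0)"
    unfolding tensor_component_def lookup_sum
    by (rule sum.cong) (auto simp: lookup_single)
  then show ?thesis
    by (auto simp: not_in_keys_iff_lookup_eq_zero)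
qed

context finite_mat_group
begin

interpretation TSV: ring "TSV G"
  by (rule ring_TSV)

lemma component_closed: "t \<in> carrier (TSV G) \<Longrightarrow> component m t \<in> carrier (TSV G)"
  by (simp add: carrier_TSV component_def tensor_component_def)

lemma component_minus:
  assumes "s \<in> carrier (TSV G)" "t \<in> carrier (TSV G)"
  shows "component m (s \<ominus>\<^bsub>TSV G\<^esub> t) = component m s \<ominus>\<^bsub>TSV G\<^esub> component m t"
proof
  fix g
  show "component m (s \<ominus>\<^bsub>TSV G\<^esub> t) g = (component m s \<ominus>\<^bsub>TSV G\<^esub> component m t) g"
    using assms
    by (intro poly_mapping_eqI)
      (simp add: minus_TSV component_closed, simp add: component_def minus_TSV lookup_minus lookup_tensor_component)
qed

lemma subgroup_TSV_filt: "subgroup (TSV_filt G m) (add_monoid (TSV G))"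
proof (rule group.subgroupI)
  show "Group.group (add_monoid (TSV G))" by (rule TSV.a_group)
  show "TSV_filt G m \<subseteq> carrier (add_monoid (TSV G))" by (auto simp: TSV_filt_def)
  show "TSV_filt G m \<noteq> {}"
    using zero_TSV by (auto simp: TSV_filt_def intro!: exI[of _ "\<zero>\<^bsub>TSV G\<^esub>"])
  fix a b assume a: "a \<in> TSV_filt G m"
  then have "(\<ominus>\<^bsub>TSV G\<^esub> a) g = - a g" for g by (simp add: TSV_filt_def uminus_TSV)
  then have "\<ominus>\<^bsub>TSV G\<^esub> a \<in> TSV_filt G m"
    using a by (auto simp: TSV_filt_def in_keys_iff)
  then show "inv\<^bsub>add_monoid (TSV G)\<^esub> a \<in> TSV_filt G m"
    unfolding a_inv_def .
  assume b: "b \<in> TSV_filt G m"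
  have "\<forall>w\<in>Poly_Mapping.keys (a g + b g). length w \<le> m" for g
    using a b keys_add[of "a g" "b g"] by (auto simp: TSV_filt_def)
  then show "a \<otimes>\<^bsub>add_monoid (TSV G)\<^esub> b \<in> TSV_filt G m"
    using a b by (auto simp: TSV_filt_def add_TSV)
qed

lemma Idl_ideal: "P \<subseteq> carrier (TSV G) \<Longrightarrow> ideal (Idl\<^bsub>TSV G\<^esub> P) (TSV G)"
  by (rule TSV.genideal_ideal)

lemma ring_quot_alg: "P \<subseteq> carrier (TSV G) \<Longrightarrow> ring (quot_alg G P)"
  unfolding quot_alg_def by (rule ideal.quotient_is_ring[OF Idl_ideal])

lemma ring_hom_quot_alg:
  "P \<subseteq> carrier (TSV G) \<Longrightarrow> ring_hom_ring (TSV G) (quot_alg G P) ((+>\<^bsub>TSV G\<^esub>) (Idl\<^bsub>TSV G\<^esub> P))"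
  unfolding quot_alg_def by (rule ideal.rcos_ring_hom_ring[OF Idl_ideal])

lemma abelian_subgroup_filt_pred:
  assumes P: "P \<subseteq> carrier (TSV G)"
  shows "abelian_subgroup (filt_pred (quot_alg G P) (quot_filt G P) m) (quot_alg G P)"
proof -
  interpret Q: ring "quot_alg G P" by (rule ring_quot_alg[OF P])
  interpret h: ring_hom_ring "TSV G" "quot_alg G P" "(+>\<^bsub>TSV G\<^esub>) (Idl\<^bsub>TSV G\<^esub> P)"
    by (rule ring_hom_quot_alg[OF P])
  show ?thesis
  proof (rule abelian_subgroupI3[OF additive_subgroupI])
    show "abelian_group (quot_alg G P)" by (rule Q.abelian_group_axioms)
    show "subgroup (filt_pred (quot_alg G P) (quot_filt G P) m) (add_monoid (quot_alg G P))"
    proof (cases m)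
      case 0
      then show ?thesis
        using group.triv_subgroup[OF Q.a_group] by (simp add: filt_pred_def)
    next
      case (Suc k)
      then show ?thesis
        using h.img_is_add_subgroup[OF subgroup_TSV_filt] by (simp add: filt_pred_def quot_filt_def)
    qed
  qed
qed

definition graded_kernel :: "(mat2 \<Rightarrow> tensor) set \<Rightarrow> (mat2 \<Rightarrow> tensor) set" where
  "graded_kernel P = {t. \<forall>m. (Idl\<^bsub>TSV G\<^esub> P) +>\<^bsub>TSV G\<^esub> component m t \<in>
     filt_pred (quot_alg G P) (quot_filt G P) m}"

text \<open>Taking components and passing to cosets are additive. Both the well-definedness of
  \<open>natural_map\<close> and its injectivity thus become statements about
  \<open>graded_kernel\<close>.\<close>

lemma graded_map_eq_iff:
  assumes P: "P \<subseteq> carrier (TSV G)" and st: "s \<in> carrier (TSV G)" "t \<in> carrier (TSV G)"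
  shows "graded_map G P s = graded_map G P t \<longleftrightarrow> s \<ominus>\<^bsub>TSV G\<^esub> t \<in> graded_kernel P"
proof -
  let ?Q = "quot_alg G P" and ?J = "Idl\<^bsub>TSV G\<^esub> P"
  let ?F = "filt_pred ?Q (quot_filt G P)"
  interpret Q: ring ?Q by (rule ring_quot_alg[OF P])
  interpret h: ring_hom_ring "TSV G" ?Q "(+>\<^bsub>TSV G\<^esub>) ?J"
    by (rule ring_hom_quot_alg[OF P])
  have "?F m +>\<^bsub>?Q\<^esub> (?J +>\<^bsub>TSV G\<^esub> component m s) = ?F m +>\<^bsub>?Q\<^esub> (?J +>\<^bsub>TSV G\<^esub> component m t) \<longleftrightarrow>
      ?J +>\<^bsub>TSV G\<^esub> component m (s \<ominus>\<^bsub>TSV G\<^esub> t) \<in> ?F m" for m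
  proof -
    have c: "component m s \<in> carrier (TSV G)" "component m t \<in> carrier (TSV G)"
      using st component_closed by auto
    then have "?J +>\<^bsub>TSV G\<^esub> component m (s \<ominus>\<^bsub>TSV G\<^esub> t) =
        (?J +>\<^bsub>TSV G\<^esub> component m s) \<ominus>\<^bsub>?Q\<^esub> (?J +>\<^bsub>TSV G\<^esub> component m t)"
      unfolding component_minus[OF st] by (simp add: TSV.minus_eq Q.minus_eq)
    then show ?thesis
      using abelian_subgroup.a_r_coset_eq_iff[OF abelian_subgroup_filt_pred[OF P]
          h.hom_closed[OF c(1)] h.hom_closed[OF c(2)]] by simp
  qed
  then show ?thesis
    by (simp add: graded_map_def graded_kernel_def fun_eq_iff)
qed

lemma relations_carrier: "relations G \<subseteq> carrier (TSV G)"
  using relations_subset_order_ge_2 by (auto simp: order_ge_2_def)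

lemma Idl_relations_subset: "Idl\<^bsub>TSV G\<^esub> (relations G) \<subseteq> order_ge_2"
  by (rule TSV.genideal_minimal[OF ideal_order_ge_2 relations_subset_order_ge_2])

text \<open>If \<open>graded_map\<close> is not constant on one coset of \<open>I(R)\<close>, then by additivity it is constant on
  none, and \<open>natural_map\<close> takes the value \<open>THE x. False\<close> everywhere.\<close>
lemma natural_map_coset:
  assumes P: "P \<subseteq> carrier (TSV G)"
    and inj: "inj_on (natural_map G P) (carrier (polynomial_skew_algebra G))"
    and t: "t \<in> carrier (TSV G)"
  shows "natural_map G P ((Idl\<^bsub>TSV G\<^esub> (relations G)) +>\<^bsub>TSV G\<^esub> t) = graded_map G P t"
proof -
  let ?I = "Idl\<^bsub>TSV G\<^esub> (relations G)"
  interpret I: ideal ?I "TSV G" by (rule Idl_ideal[OF relations_carrier])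
  interpret hI: ring_hom_ring "TSV G" "polynomial_skew_algebra G" "(+>\<^bsub>TSV G\<^esub>) ?I"
    by (rule ring_hom_quot_alg[OF relations_carrier])
  have coset: "?I +>\<^bsub>TSV G\<^esub> s = (\<lambda>j. j \<oplus>\<^bsub>TSV G\<^esub> s) ` ?I" for s
    by (auto simp: a_r_coset_def')
  have Icarr: "j \<in> carrier (TSV G)" if "j \<in> ?I" for j
    using that I.a_subset by auto
  have shift: "graded_map G P (j \<oplus>\<^bsub>TSV G\<^esub> s) = graded_map G P s \<longleftrightarrow> j \<in> graded_kernel P"
    if "j \<in> ?I" "s \<in> carrier (TSV G)" for j s
  proof -
    have "(j \<oplus>\<^bsub>TSV G\<^esub> s) \<ominus>\<^bsub>TSV G\<^esub> s = j"
      using that Icarr by (simp add: TSV.minus_eq TSV.a_assoc TSV.r_neg)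
    then show ?thesis
      using graded_map_eq_iff[OF P] that Icarr by simp
  qed
  have "?I \<subseteq> graded_kernel P"
  proof (rule ccontr)
    assume "\<not> ?thesis"
    then obtain j where j: "j \<in> ?I" "j \<notin> graded_kernel P" by blast
    have junk: "natural_map G P (?I +>\<^bsub>TSV G\<^esub> s) = (THE x. False)" if s: "s \<in> carrier (TSV G)" for s
    proof -
      have "\<zero>\<^bsub>TSV G\<^esub> \<oplus>\<^bsub>TSV G\<^esub> s \<in> ?I +>\<^bsub>TSV G\<^esub> s" "j \<oplus>\<^bsub>TSV G\<^esub> s \<in> ?I +>\<^bsub>TSV G\<^esub> s"
        using j(1) I.zero_closed unfolding coset by blast+
      then have "graded_map G P s \<in> graded_map G P ` (?I +>\<^bsub>TSV G\<^esub> s)"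
        "graded_map G P (j \<oplus>\<^bsub>TSV G\<^esub> s) \<in> graded_map G P ` (?I +>\<^bsub>TSV G\<^esub> s)"
        using s by auto
      moreover have "graded_map G P (j \<oplus>\<^bsub>TSV G\<^esub> s) \<noteq> graded_map G P s"
        using shift[OF j(1) s] j(2) by simp
      ultimately have "(graded_map G P ` (?I +>\<^bsub>TSV G\<^esub> s) = {x}) = False" for x
        by (metis singletonD)
      then show ?thesis
        by (simp add: natural_map_def the_elem_def)
    qed
    \<comment> \<open>With the same default value on every coset, injectivity puts the unit into
      I(R), where every word has length at least 2.\<close>
    have "?I +>\<^bsub>TSV G\<^esub> \<one>\<^bsub>TSV G\<^esub> = ?I +>\<^bsub>TSV G\<^esub> \<zero>\<^bsub>TSV G\<^esub>"
      by (intro inj_onD[OF inj] hI.hom_closed TSV.one_closed TSV.zero_closed)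
        (simp only: junk TSV.one_closed TSV.zero_closed)
    then have "\<one>\<^bsub>TSV G\<^esub> \<ominus>\<^bsub>TSV G\<^esub> \<zero>\<^bsub>TSV G\<^esub> \<in> ?I"
      using I.a_r_coset_eq_iff[OF TSV.one_closed TSV.zero_closed] by simp
    then have "\<one>\<^bsub>TSV G\<^esub> \<in> order_ge_2"
      using Idl_relations_subset by (auto simp: TSV.minus_eq)
    then have "\<forall>w\<in>Poly_Mapping.keys (1 :: tensor). 2 \<le> length w"
      by (auto simp: order_ge_2_def one_TSV split: if_splits)
    then show False
      by (simp add: zero_list_def)
  qed
  then have "graded_map G P ` (?I +>\<^bsub>TSV G\<^esub> t) = (\<lambda>j. graded_map G P t) ` ?I"
    unfolding coset image_image by (intro image_cong) (auto simp: shift t)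
  also have "\<dots> = {graded_map G P t}"
    by (rule image_constant[OF I.zero_closed])
  finally have "graded_map G P ` (?I +>\<^bsub>TSV G\<^esub> t) = {graded_map G P t}" .
  then show ?thesis
    by (simp add: natural_map_def)
qed

text \<open>Such a \<open>t\<close> has the same image as 0, so injectivity of
  \<open>natural_map\<close> places it in I(R).\<close>

lemma graded_kernel_subset:
  assumes P: "P \<subseteq> carrier (TSV G)"
    and inj: "inj_on (natural_map G P) (carrier (polynomial_skew_algebra G))"
    and t: "t \<in> carrier (TSV G)" "t \<in> graded_kernel P"
  shows "t \<in> order_ge_2"
proof -
  let ?I = "Idl\<^bsub>TSV G\<^esub> (relations G)"
  interpret I: ideal ?I "TSV G" by (rule Idl_ideal[OF relations_carrier])
  interpret hI: ring_hom_ring "TSV G" "polynomial_skew_algebra G" "(+>\<^bsub>TSV G\<^esub>) ?I"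
    by (rule ring_hom_quot_alg[OF relations_carrier])
  have t0: "t \<ominus>\<^bsub>TSV G\<^esub> \<zero>\<^bsub>TSV G\<^esub> = t"
    using t by (simp add: TSV.minus_eq)
  have "graded_map G P t = graded_map G P \<zero>\<^bsub>TSV G\<^esub>"
    using graded_map_eq_iff[OF P t(1) TSV.zero_closed] t by (simp add: t0)
  then have "natural_map G P (?I +>\<^bsub>TSV G\<^esub> t) = natural_map G P (?I +>\<^bsub>TSV G\<^esub> \<zero>\<^bsub>TSV G\<^esub>)"
    by (simp only: natural_map_coset[OF P inj] t(1) TSV.zero_closed)
  then have "?I +>\<^bsub>TSV G\<^esub> t = ?I +>\<^bsub>TSV G\<^esub> \<zero>\<^bsub>TSV G\<^esub>"
    by (intro inj_onD[OF inj] hI.hom_closed t(1) TSV.zero_closed)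
  then have "t \<in> ?I"
    using I.a_r_coset_eq_iff[OF t(1) TSV.zero_closed] by (simp add: t0)
  then show ?thesis using Idl_relations_subset by auto
qed

lemma component_add_component:
  assumes "p \<in> TSV_filt G 1"
  shows "component 1 p \<oplus>\<^bsub>TSV G\<^esub> component 0 p = p"
proof
  fix g
  show "(component 1 p \<oplus>\<^bsub>TSV G\<^esub> component 0 p) g = p g"
  proof (rule poly_mapping_eqI)
    fix w
    have "length w \<le> 1 \<or> Poly_Mapping.lookup (p g) w = 0"
      using assms by (auto simp: TSV_filt_def in_keys_iff)
    then consider "length w = 0" | "length w = 1" | "Poly_Mapping.lookup (p g) w = 0"
      by linarith
    then show "Poly_Mapping.lookup ((component 1 p \<oplus>\<^bsub>TSV G\<^esub> component 0 p) g) w =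
        Poly_Mapping.lookup (p g) w"
      by cases (auto simp: add_TSV lookup_add component_def lookup_tensor_component)
  qed
qed

lemma component_component:
  "component m (component n p) = (if m = n then component n p else \<zero>\<^bsub>TSV G\<^esub>)"
proof
  fix g
  show "component m (component n p) g = (if m = n then component n p else \<zero>\<^bsub>TSV G\<^esub>) g"
    by (rule poly_mapping_eqI) (auto simp: component_def lookup_tensor_component zero_TSV)
qed

lemma graded_kernel_homogeneous:
  assumes P: "P \<subseteq> carrier (TSV G)"
    and m: "(Idl\<^bsub>TSV G\<^esub> P) +>\<^bsub>TSV G\<^esub> component m t \<in> filt_pred (quot_alg G P) (quot_filt G P) m"
  shows "component m t \<in> graded_kernel P"
proof -
  interpret h: ring_hom_ring "TSV G" "quot_alg G P" "(+>\<^bsub>TSV G\<^esub>) (Idl\<^bsub>TSV G\<^esub> P)"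
    by (rule ring_hom_quot_alg[OF P])
  have "\<zero>\<^bsub>quot_alg G P\<^esub> \<in> filt_pred (quot_alg G P) (quot_filt G P) n" for n
    using abelian_subgroup_filt_pred[OF P] additive_subgroup.zero_closed
    by (auto simp: abelian_subgroup_def)
  then show ?thesis
    using m by (auto simp: graded_kernel_def component_component)
qed

lemma order_ge_2_component:
  assumes "component m t \<in> order_ge_2" "m < 2"
  shows "component m t = \<zero>\<^bsub>TSV G\<^esub>"
proof
  fix g
  show "component m t g = \<zero>\<^bsub>TSV G\<^esub> g"
  proof (rule poly_mapping_eqI, rule ccontr)
    fix w assume "Poly_Mapping.lookup (component m t g) w \<noteq> Poly_Mapping.lookup (\<zero>\<^bsub>TSV G\<^esub> g) w"
    then have "w \<in> Poly_Mapping.keys (component m t g)" and "length w = m"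
      by (auto simp: zero_TSV in_keys_iff component_def lookup_tensor_component split: if_splits)
    moreover from this(1) have "2 \<le> length w"
      using assms(1) unfolding order_ge_2_def by blast
    ultimately show False
      using assms(2) by simp
  qed
qed

text \<open>Let \<open>a\<close> and \<open>b\<close> be the parts of \<open>p\<close> of degree 1
  and 0. Modulo I(P), \<open>a\<close> equals \<open>- b\<close>, which has smaller degree, so
  \<open>a\<close> lies in the graded kernel and vanishes. Then \<open>b = p\<close> is 0 modulo
  I(P) and vanishes for the same reason.\<close>

lemma PBW_low_degree:
  assumes P: "P \<subseteq> carrier (TSV G)"
    and inj: "inj_on (natural_map G P) (carrier (polynomial_skew_algebra G))"
    and p: "p \<in> P" "p \<in> TSV_filt G 1"
  shows "p = \<zero>\<^bsub>TSV G\<^esub>"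
proof -
  let ?J = "Idl\<^bsub>TSV G\<^esub> P" and ?Q = "quot_alg G P"
  interpret J: ideal ?J "TSV G" by (rule Idl_ideal[OF P])
  interpret Q: ring ?Q by (rule ring_quot_alg[OF P])
  interpret h: ring_hom_ring "TSV G" ?Q "(+>\<^bsub>TSV G\<^esub>) ?J"
    by (rule ring_hom_quot_alg[OF P])
  have pc: "p \<in> carrier (TSV G)" using p P by auto
  define a where "a = component 1 p"
  define b where "b = component 0 p"
  have c: "a \<in> carrier (TSV G)" "b \<in> carrier (TSV G)"
    using pc by (simp_all add: a_def b_def component_closed)
  have ab: "a \<oplus>\<^bsub>TSV G\<^esub> b = p"
    using component_add_component[OF p(2)] by (simp add: a_def b_def)
  have Jp: "?J +>\<^bsub>TSV G\<^esub> p = \<zero>\<^bsub>?Q\<^esub>"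
  proof -
    have "p \<ominus>\<^bsub>TSV G\<^esub> \<zero>\<^bsub>TSV G\<^esub> \<in> ?J"
      using TSV.genideal_self[OF P] p pc by (auto simp: TSV.minus_eq)
    then have "?J +>\<^bsub>TSV G\<^esub> p = ?J +>\<^bsub>TSV G\<^esub> \<zero>\<^bsub>TSV G\<^esub>"
      using J.a_r_coset_eq_iff[OF pc TSV.zero_closed] by simp
    then show ?thesis by simp
  qed
  have "?J +>\<^bsub>TSV G\<^esub> a = ?J +>\<^bsub>TSV G\<^esub> (\<ominus>\<^bsub>TSV G\<^esub> b)"
  proof -
    have "a \<ominus>\<^bsub>TSV G\<^esub> (\<ominus>\<^bsub>TSV G\<^esub> b) = p"
      using c ab by (simp add: TSV.minus_eq)
    then show ?thesis
      using J.a_r_coset_eq_iff[of a "\<ominus>\<^bsub>TSV G\<^esub> b"] c TSV.genideal_self[OF P] p by auto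
  qed
  moreover have "\<ominus>\<^bsub>TSV G\<^esub> b \<in> TSV_filt G 0"
  proof -
    have "b \<in> TSV_filt G 0"
      using c(2) by (auto simp: TSV_filt_def b_def component_def in_keys_iff lookup_tensor_component
          split: if_splits)
    then show ?thesis
      using subgroup.m_inv_closed[OF subgroup_TSV_filt] unfolding a_inv_def by blast
  qed
  ultimately have "?J +>\<^bsub>TSV G\<^esub> a \<in> filt_pred ?Q (quot_filt G P) 1"
    by (auto simp: filt_pred_def quot_filt_def)
  then have a: "a = \<zero>\<^bsub>TSV G\<^esub>"
    using graded_kernel_subset[OF P inj] graded_kernel_homogeneous[OF P, of 1 p] c(1)
      order_ge_2_component[of 1 p] by (simp add: a_def)
  then have "b = p" using ab c by simp
  then have "?J +>\<^bsub>TSV G\<^esub> b \<in> filt_pred ?Q (quot_filt G P) 0"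
    using Jp by (simp add: filt_pred_def)
  then have "b = \<zero>\<^bsub>TSV G\<^esub>"
    using graded_kernel_subset[OF P inj] graded_kernel_homogeneous[OF P, of 0 p] c(2)
      order_ge_2_component[of 0 p] by (simp add: b_def)
  then show ?thesis using \<open>b = p\<close> by simp
qed

end

section \<open>Triviality of the PBW deformations\<close>

context small_group
begin

interpretation TSV: ring "TSV G"
  by (rule ring_TSV)

text \<open>The constant part of \<open>l\<close> vanishes because \<open>det x \<noteq> 1\<close>. A nonzero linear part would be an
  eigenvector of the inverse of \<open>x\<close> whose eigenvalue is its determinant, so the other eigenvalue would be 1.\<close>
lemma no_low_degree_semiinvariant:
  assumes x: "x \<in> G" "det x \<noteq> 1"
    and l: "\<forall>w\<in>Poly_Mapping.keys l. length w \<le> 1"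
    and eq: "tensor_act x l = scal (1 / det x) * l"
  shows "l = 0"
proof -
  define b where "b = matrix_inv x"
  define d where "d = det b"
  let ?c = "Poly_Mapping.lookup l"
  have bG: "b \<in> G" using x by (simp add: b_def inv_closed)
  have "det x * d = 1"
    unfolding d_def b_def using inv_right[OF x(1)] by (metis det_mul det_I)
  then have d: "1 / det x = d" "d \<noteq> 1"
    using x det_nonzero[OF x(1)] by (auto simp: field_simps)
  have "d \<noteq> 0" using det_nonzero[OF bG] by (simp add: d_def)
  have sub: "Poly_Mapping.keys l \<subseteq> {[], [1], [2]}"
  proof
    fix w assume "w \<in> Poly_Mapping.keys l"
    with l have "length w \<le> 1" by blast
    then show "w \<in> {[], [1], [2]}"
      using exhaust_2 by (cases w) auto
  qed
  have act: "tensor_act x l = scal (?c []) + scal (?c [1]) * letter_act x 1 + scal (?c [2]) * letter_act x 2"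
    by (subst tensor_act_eq[OF _ sub]) (simp_all add: word_act_def add.assoc)
  have lookup_eq: "Poly_Mapping.lookup (tensor_act x l) w = d * ?c w" for w
    using eq d by (simp add: lookup_scal_mult)
  have "?c [] = d * ?c []"
    using lookup_eq[of "[]"] unfolding act
    by (simp add: lookup_add lookup_scal_mult letter_act_def lookup_sum lookup_single)
  then have c0: "?c [] = 0" using d(2) by simp
  \<comment> \<open>The linear coefficients form a row eigenvector of \<open>b\<close> with
    eigenvalue \<open>d\<close>.\<close>
  have c: "?c [1] * b $ 1 $ j + ?c [2] * b $ 2 $ j = d * ?c [j]" for j
    using lookup_eq[of "[j]"] unfolding act
    by (simp add: lookup_add lookup_scal_mult letter_act_def lookup_sum lookup_single b_def when_def)
  have "1 - trace b + d \<noteq> 0"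
    unfolding d_def using bG d(2) by (intro no_eigenvalue_1) (auto simp: d_def)
  then have D: "d * (1 - trace b + d) \<noteq> 0" using \<open>d \<noteq> 0\<close> by simp
  \<comment> \<open>The characteristic polynomial of \<open>b\<close> at its determinant
    \<open>d\<close> is \<open>d\<close> times its value at 1. As it is nonzero, Cramer's rule below
    makes both linear coefficients vanish.\<close>
  have D_eq: "d * (1 - trace b + d) = (b$1$1 - d) * (b$2$2 - d) - b$1$2 * b$2$1"
    by (simp add: d_def mat2_simps algebra_simps)
  have 1: "?c [1] * (b$1$1 - d) + ?c [2] * b$2$1 = 0"
    and 2: "?c [1] * b$1$2 + ?c [2] * (b$2$2 - d) = 0"
    using c[of 1] c[of 2] by (simp_all add: algebra_simps)
  have "?c [1] * (d * (1 - trace b + d)) =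
      (?c [1] * (b$1$1 - d) + ?c [2] * b$2$1) * (b$2$2 - d) -
      b$2$1 * (?c [1] * b$1$2 + ?c [2] * (b$2$2 - d))"
    unfolding D_eq by (simp add: algebra_simps)
  also have "\<dots> = 0" unfolding 1 2 by simp
  finally have c1: "?c [1] = 0" using D by simp
  have "?c [2] * (d * (1 - trace b + d)) =
      (?c [1] * b$1$2 + ?c [2] * (b$2$2 - d)) * (b$1$1 - d) -
      b$1$2 * (?c [1] * (b$1$1 - d) + ?c [2] * b$2$1)"
    unfolding D_eq by (simp add: algebra_simps)
  also have "\<dots> = 0" unfolding 1 2 by simp
  finally have c2: "?c [2] = 0" using D by simp
  show ?thesis
  proof (rule poly_mapping_eqI)
    fix w
    have "w \<in> {[], [1], [2]} \<or> ?c w = 0"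
      using sub by (auto simp: in_keys_iff)
    then show "?c w = Poly_Mapping.lookup 0 w"
      using c0 c1 c2 by auto
  qed
qed

text \<open>Conjugation by \<open>g\<close> scales the commutator by \<open>1 / det g\<close>. The element of \<open>P\<close> above the
  commutator is scaled by the same factor, since \<open>P\<close> contains no elements of lower degree.\<close>
lemma plane_commutator_mem:
  assumes nSL: "\<not> G \<subseteq> SL2" and P: "Se_submodule G P" "P \<subseteq> TSV_filt G 2"
    and low: "\<And>p. p \<in> P \<Longrightarrow> p \<in> TSV_filt G 1 \<Longrightarrow> p = \<zero>\<^bsub>TSV G\<^esub>"
    and p: "p \<in> P" "component 2 p = plane_commutator"
  shows "plane_commutator \<in> P"
proof -
  have pc: "p \<in> carrier (TSV G)" using P(1) p by (auto simp: Se_submodule_def)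
  define l where "l = (\<lambda>k. p k - plane_commutator k)"
  have pl: "p k = plane_commutator k + l k" for k by (simp add: l_def)
  have l_len: "length w \<le> 1" if "w \<in> Poly_Mapping.keys (l k)" for w k
  proof -
    have "Poly_Mapping.lookup (l k) w = Poly_Mapping.lookup (p k) w - Poly_Mapping.lookup (component 2 p k) w"
      by (simp add: l_def lookup_minus p)
    then have "length w \<noteq> 2" "w \<in> Poly_Mapping.keys (p k)"
      using that by (auto simp: component_def lookup_tensor_component in_keys_iff split: if_splits)
    then have "length w \<le> 2" using P(2) p(1) by (auto simp: TSV_filt_def)
    then show ?thesis using \<open>length w \<noteq> 2\<close> by linarith
  qed
  have "l k = 0" for k
  proof (cases "k \<in> G")
    case False
    then have "k \<noteq> mat 1" using one_closed by auto
    then show ?thesis using False pc by (simp add: l_def carrier_TSV plane_commutator_def)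
  next
    case k: True
    obtain x where x: "x \<in> G" "x ** k = k ** x" "det x \<noteq> 1"
      using commuting_det_ne_1[OF nSL k] by blast
    \<comment> \<open>Conjugation and scaling have the same effect on the commutator, so
      \<open>?q\<close> and \<open>?r\<close> differ only in degree at most 1. Their difference lies
      in \<open>P\<close> and is therefore 0.\<close>
    let ?q = "group_elt x 1 \<otimes>\<^bsub>TSV G\<^esub> p \<otimes>\<^bsub>TSV G\<^esub> group_elt (matrix_inv x) 1"
    let ?r = "group_elt (mat 1) (1 / det x) \<otimes>\<^bsub>TSV G\<^esub> p"
    have qr: "?q \<in> P" "?r \<in> P"
      using P(1) p(1) group_elt_mem x(1) inv_closed one_closed unfolding Se_submodule_def by simp_all
    have qrc: "?q \<in> carrier (TSV G)" "?r \<in> carrier (TSV G)"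
      using qr P(1) by (auto simp: Se_submodule_def)
    have diff: "(?q \<ominus>\<^bsub>TSV G\<^esub> ?r) h =
      tensor_act x (l (matrix_inv x ** h ** x)) - scal (1 / det x) * l h" if h: "h \<in> G" for h
    proof -
      have "tensor_act x (plane_commutator (matrix_inv x ** h ** x)) =
          scal (1 / det x) * plane_commutator h"
      proof (cases "h = mat 1")
        case True
        then show ?thesis
          using tensor_act_word_commutator[OF x(1)] x(1) by (simp add: plane_commutator_def inv_left)
      next
        case False
        have "matrix_inv x ** h ** x \<noteq> mat 1"
        proof
          assume "matrix_inv x ** h ** x = mat 1"
          then have "x ** (matrix_inv x ** (h ** x)) = x ** mat 1"
            by (simp add: matrix_mul_assoc)
          then have "h ** x = mat 1 ** x"
            using x(1) by (simp add: inv_right_cancel)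
          then have "h = mat 1"
            by (rule iffD1[OF mult_right_cancel[OF x(1)]])
          with False show False by simp
        qed
        with False show ?thesis by (simp add: plane_commutator_def tensor_act_zero)
      qed
      moreover have "?q h = tensor_act x (p (matrix_inv x ** h ** x))"
        by (rule conj_group_elt[OF x(1) h])
      moreover have "?r h = scal (1 / det x) * p h"
        using group_elt_mult[OF one_closed h] by (simp add: tensor_act_mat_1 matrix_inv_one)
      ultimately show ?thesis
        unfolding minus_TSV[OF qrc] by (simp add: pl tensor_act_add distrib_left)
    qed
    have "?q \<ominus>\<^bsub>TSV G\<^esub> ?r \<in> TSV_filt G 1"
    proof -
      have "length w \<le> 1" if w: "w \<in> Poly_Mapping.keys ((?q \<ominus>\<^bsub>TSV G\<^esub> ?r) h)" for w h
      proof -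
        have h: "h \<in> G"
          using w TSV.minus_closed[OF qrc] by (auto simp: carrier_TSV)
        from w consider "w \<in> Poly_Mapping.keys (tensor_act x (l (matrix_inv x ** h ** x)))"
          | "w \<in> Poly_Mapping.keys (l h)"
          unfolding diff[OF h]
          by (cases "Poly_Mapping.lookup (l h) w = 0") (auto simp: in_keys_iff lookup_minus lookup_scal_mult)
        then show ?thesis
        proof cases
          case 1
          then show ?thesis by (rule keys_tensor_act) (use l_len in auto)
        qed (rule l_len)
      qed
      then show ?thesis
        using TSV.minus_closed[OF qrc] unfolding TSV_filt_def by blast
    qed
    moreover have "?q \<ominus>\<^bsub>TSV G\<^esub> ?r \<in> P"
      by (rule Se_submodule_minus[OF P(1) qr])
    ultimately have "?q \<ominus>\<^bsub>TSV G\<^esub> ?r = \<zero>\<^bsub>TSV G\<^esub>"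
      using low by blast
    \<comment> \<open>Because \<open>x\<close> commutes with \<open>k\<close>, the equation relates
      the coefficient \<open>l k\<close> to itself.\<close>
    moreover have "matrix_inv x ** k ** x = matrix_inv x ** (x ** k)"
      unfolding x(2) by (rule matrix_mul_assoc[symmetric])
    then have "matrix_inv x ** k ** x = k"
      by (simp add: inv_left_cancel x(1))
    ultimately have "tensor_act x (l k) = scal (1 / det x) * l k"
      using diff[OF k] by (simp add: zero_TSV)
    then show ?thesis
      using no_low_degree_semiinvariant[OF x(1,3)] l_len by blast
  qed
  then have "p = plane_commutator" by (simp add: fun_eq_iff l_def)
  with p(1) show ?thesis by simp
qed

lemma PBW_deformation_eq_relations:
  assumes nSL: "\<not> G \<subseteq> SL2" and PBW: "PBW_deformation G P"
  shows "P = relations G"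
proof -
  have P: "Se_submodule G P" "P \<subseteq> TSV_filt G 2" "component 2 ` P = relations G"
    and inj: "inj_on (natural_map G P) (carrier (polynomial_skew_algebra G))"
    using PBW by (simp_all add: PBW_deformation_def deformation_def ring_iso_def bij_betw_def)
  have Pc: "P \<subseteq> carrier (TSV G)" using P(1) by (simp add: Se_submodule_def)
  have low: "p = \<zero>\<^bsub>TSV G\<^esub>" if "p \<in> P" "p \<in> TSV_filt G 1" for p
    by (rule PBW_low_degree[OF Pc inj that])
  have "plane_commutator \<in> relations G"
    unfolding relations_def by (rule subsetD[OF hull_subset plane_commutator_in])
  then have "plane_commutator \<in> component 2 ` P"
    by (simp only: P(3))
  then obtain p where "plane_commutator = component 2 p" "p \<in> P"
    by (rule imageE)
  then have "plane_commutator \<in> P"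
    by (intro plane_commutator_mem[OF nSL P(1,2) low, of p]) (simp_all only:)
  then have sub: "relations G \<subseteq> P"
    unfolding relations_def by (intro hull_minimal commutators_subset P(1))
  \<comment> \<open>The quadratic part of \<open>q\<close> lies in the relations and hence in
    \<open>P\<close>. The rest of \<open>q\<close> is then an element of \<open>P\<close> of degree
    at most 1, which must be 0.\<close>
  have "P \<subseteq> relations G"
  proof
    fix q assume q: "q \<in> P"
    let ?r = "component 2 q"
    have r: "?r \<in> relations G" unfolding P(3)[symmetric] by (rule imageI[OF q])
    then have rP: "?r \<in> P" by (rule subsetD[OF sub])
    have c: "q \<in> carrier (TSV G)" "?r \<in> carrier (TSV G)" using q rP Pc by auto
    have "length w \<le> 1" if w: "w \<in> Poly_Mapping.keys ((q \<ominus>\<^bsub>TSV G\<^esub> ?r) h)" for w h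
    proof -
      have "length w \<noteq> 2" "w \<in> Poly_Mapping.keys (q h)"
        using w unfolding minus_TSV[OF c]
        by (auto simp: component_def lookup_tensor_component in_keys_iff lookup_minus
            split: if_splits)
      moreover from this(2) have "length w \<le> 2" using P(2) q by (auto simp: TSV_filt_def)
      ultimately show ?thesis by linarith
    qed
    then have "q \<ominus>\<^bsub>TSV G\<^esub> ?r \<in> TSV_filt G 1"
      using TSV.minus_closed[OF c] unfolding TSV_filt_def by blast
    then have "q \<ominus>\<^bsub>TSV G\<^esub> ?r = \<zero>\<^bsub>TSV G\<^esub>"
      by (intro low Se_submodule_minus[OF P(1) q rP])
    then have "q h - ?r h = 0" for h
      unfolding minus_TSV[OF c, symmetric] by (simp only: zero_TSV)
    then have "q = ?r" by (simp add: fun_eq_iff)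
    then show "q \<in> relations G" using r by simp
  qed
  then show ?thesis using sub by blast
qed

lemma trivial_deformation_relations: "trivial_deformation G (relations G)"
proof -
  let ?z = "\<lambda>_ :: mat2 \<Rightarrow> tensor. \<zero>\<^bsub>TSV G\<^esub>"
  have z: "\<zero>\<^bsub>TSV G\<^esub> \<in> TSV_degree G m" for m
    using TSV.zero_closed by (auto simp: TSV_degree_def zero_TSV)
  have "Se_map G (relations G) (TSV_degree G m) ?z" for m
    using z by (auto simp: Se_map_def TSV_degree_def)
  moreover have "r \<ominus>\<^bsub>TSV G\<^esub> \<zero>\<^bsub>TSV G\<^esub> \<ominus>\<^bsub>TSV G\<^esub> \<zero>\<^bsub>TSV G\<^esub> = r" if "r \<in> relations G" for r
    using that relations_carrier by (auto simp: TSV.minus_eq)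
  then have "relations G =
      {r \<ominus>\<^bsub>TSV G\<^esub> ?z r \<ominus>\<^bsub>TSV G\<^esub> ?z r | r. r \<in> relations G}"
    by force
  ultimately have "deformation_maps G (relations G) ?z ?z"
    unfolding deformation_maps_def by blast
  then show ?thesis
    unfolding trivial_deformation_def by blast
qed

end

theorem theorem5p0p2:
  fixes G :: "mat2 set"
  assumes "subgroup G GL2" and "finite G"
    and "small G"
    and "\<not> G \<subseteq> SL2"
  shows "\<not> (\<exists>P. PBW_deformation G P \<and> \<not> trivial_deformation G P)"
proof -
  interpret small_group G
    by (intro small_group.intro finite_mat_group.intro small_group_axioms.intro assms(1-3))
  show ?thesis
    using PBW_deformation_eq_relations[OF assms(4)] trivial_deformation_relations by auto
qed

end
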